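(* Let $\mathcal{P}$ be a regular $3$-polytope inscribed in a sphere of radius $1$ in $\mathbb{R}^3$. Let $V$ be the number of vertices of $\mathcal{P}$, let $k$ be the number of distinct chord lengths of $\mathcal{P}$, and let $d_1,\dots,d_k$ be these distinct chord lengths. 1. If $\mathcal{P}$ is a tetrahedron, then $\sum_{i=1}^{k}d_i^2\in\mathbb{Q}$. 2. If $\mathcal{P}$ is an octahedron or a cube, then $\sum_{i=1}^{k}d_i^2=V$. 3. If $\mathcal{P}$ is an icosahedron or a dodecahedron, then $\sum_{i=1}^{k}d_i^2=2k+2$.
   Context: A regular $3$-polytope is one of the five regular convex polyhedra (tetrahedron, octahedron, cube, icosahedron, dodecahedron, all regular). It is inscribed in a sphere if all its vertices lie on the sphere. A chord is a line segment whose endpoints are two distinct vertices of the polytope (so chords are all edges and all diagonals). *)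

theory Defs
  imports "HOL-Analysis.Analysis"
begin

definition vertices :: "(real ^ 3) set \<Rightarrow> (real ^ 3) set" where
  "vertices P = {v. v extreme_point_of P}"

text \<open>The (filled) regular \<open>p\<close>-gon: the convex hull of \<open>p\<close> equally spaced points on a circle of
  radius \<open>r\<close>. The circle has centre \<open>c\<close> and lies in the plane through \<open>c\<close> spanned by the
  orthonormal vectors \<open>e\<close> and \<open>f\<close>. Two regular \<open>p\<close>-gons are congruent iff they have the same
  circumradius \<open>r\<close>.\<close>

definition regular_polygon :: "nat \<Rightarrow> real \<Rightarrow> (real ^ 3) set \<Rightarrow> bool" where
  "regular_polygon p r F \<longleftrightarrow> 3 \<le> p \<and> 0 < r \<and>
     (\<exists>c e f. norm e = 1 \<and> norm f = 1 \<and> e \<bullet> f = 0 \<and>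
        F = convex hull
          ((\<lambda>j. c + (r * cos (2 * pi * real j / real p)) *\<^sub>R e
                  + (r * sin (2 * pi * real j / real p)) *\<^sub>R f) ` {..<p}))"

text \<open>The regular convex polyhedra with Schlaefli symbol \<open>{p,q}\<close>: the faces are congruent regular
  \<open>p\<close>-gons, and exactly \<open>q\<close> of them meet at each vertex.\<close>

definition regular_polyhedron :: "nat \<Rightarrow> nat \<Rightarrow> (real ^ 3) set \<Rightarrow> bool" where
  "regular_polyhedron p q P \<longleftrightarrow> polytope P \<and> aff_dim P = 3 \<and>
     (\<exists>r. \<forall>F. F facet_of P \<longrightarrow> regular_polygon p r F) \<and>
     (\<forall>v\<in>vertices P. card {F. F facet_of P \<and> v \<in> F} = q)"

definition regular_tetrahedron :: "(real ^ 3) set \<Rightarrow> bool" where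
  "regular_tetrahedron P \<longleftrightarrow> regular_polyhedron 3 3 P"

definition regular_octahedron :: "(real ^ 3) set \<Rightarrow> bool" where
  "regular_octahedron P \<longleftrightarrow> regular_polyhedron 3 4 P"

definition cube :: "(real ^ 3) set \<Rightarrow> bool" where
  "cube P \<longleftrightarrow> regular_polyhedron 4 3 P"

definition regular_icosahedron :: "(real ^ 3) set \<Rightarrow> bool" where
  "regular_icosahedron P \<longleftrightarrow> regular_polyhedron 3 5 P"

definition regular_dodecahedron :: "(real ^ 3) set \<Rightarrow> bool" where
  "regular_dodecahedron P \<longleftrightarrow> regular_polyhedron 5 3 P"

definition regular_3_polytope :: "(real ^ 3) set \<Rightarrow> bool" where
  "regular_3_polytope P \<longleftrightarrow> regular_tetrahedron P \<or> regular_octahedron P \<or> cube P \<or>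
     regular_icosahedron P \<or> regular_dodecahedron P"

definition inscribed_in_sphere :: "(real ^ 3) set \<Rightarrow> real ^ 3 \<Rightarrow> real \<Rightarrow> bool" where
  "inscribed_in_sphere P c r \<longleftrightarrow> vertices P \<subseteq> sphere c r"

definition chord_lengths :: "(real ^ 3) set \<Rightarrow> real set" where
  "chord_lengths P = {dist v w | v w. v \<in> vertices P \<and> w \<in> vertices P \<and> v \<noteq> w}"

end

theory Submission
  imports Defs
begin

text \<open>
  Measure everything from the centre of the sphere, so that the vertices become unit vectors.
  Call \<open>u, v, w\<close> a corner if they are consecutive vertices of a facet. All corners have the
  same shape: \<open>u \<bullet> v = v \<bullet> w = \<alpha>\<close>, while \<open>u \<bullet> w\<close> is determined by \<open>\<alpha>\<close> and \<open>p\<close>; moreover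
  the vertex that follows \<open>w\<close> in the facet is \<open>u + \<kappa> (w - v)\<close> with
  \<open>\<kappa> = 1 + 2 cos (2 \<pi> / p)\<close>, because in a regular \<open>p\<close>-gon the chord from the first to the last
  of four consecutive vertices is \<open>\<kappa>\<close> times the side parallel to it.

  The edge \<open>uv\<close> lies in a second facet, so it has another corner \<open>u, v, w'\<close>. In dimension three
  a unit vector with given inner products with \<open>u\<close> and \<open>v\<close> is unique up to reflection in the plane
  of \<open>u\<close> and \<open>v\<close>; hence \<open>w\<close> and \<open>w'\<close> are mirror images, there is no third corner on the directed
  edge, and \<open>w + w' = g u + (2 - g) \<alpha> v\<close> for one constant \<open>g\<close> (lemma \<open>corner_reflect\<close>). So
  the neighbours of \<open>v\<close> form a 2-regular graph, and by double counting it has \<open>q\<close> nodes. A 2-regular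
  graph with at most five nodes is a single cycle, and running the recurrence once round the cycle
  yields \<open>g = -1\<close>, \<open>g = 0\<close> or \<open>g\<^sup>2 + g = 1\<close> for \<open>q = 3, 4, 5\<close>. Then
  \<open>(2 - g) (1 + \<alpha>) = 2 (1 + \<kappa>)\<close> determines \<open>\<alpha>\<close>. The two roots in the case \<open>q = 5\<close> belong to a
  pentagon and to a pentagram as vertex figure. They need not be told apart, since what follows
  uses only the equation for \<open>g\<close>.

  From now on vertices can be computed by walking along edges, and this is linear algebra. A walk of a
  few steps from any vertex of the four polyhedra other than the tetrahedron ends at its antipode.
  In a centrally symmetric set of unit vectors a distance \<open>d < 2\<close> is accompanied by
  \<open>sqrt (4 - d\<^sup>2)\<close>, so the squares of the \<open>k - 1\<close> distances other than \<open>2\<close> have mean \<open>2\<close>, and the sum of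
  the squares of all distances is \<open>2 (k - 1) + 4 = 2 k + 2\<close> (lemma \<open>sum_distances_antipodal\<close>). This settles the
  icosahedron and the dodecahedron without a list of their vertices.

  For the tetrahedron, the octahedron and the cube the walks reach 4, 6 and 8 vertices. There are
  no others: the facets met on the walks give inequalities for a further vertex \<open>x\<close>, and together
  with \<open>norm x = 1\<close> they put \<open>x\<close> among the vertices already found. The octahedron has \<open>k = 2\<close>, the cube
  \<open>k = 3\<close>, so that \<open>2 k + 2\<close> is the number of vertices; all chords of the tetrahedron have squared
  length \<open>8/3\<close>.
\<close>

section \<open>Regular polygons\<close>

text \<open>Balls are strictly convex, so no point of a sphere lies inside a segment of the ball.\<close>
lemma convex_hull_sphere_extreme_points:
  fixes W :: "'a::euclidean_space set"
  assumes "W \<subseteq> sphere m r"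
  shows "{x. x extreme_point_of (convex hull W)} = W"
proof (intro subset_antisym subsetI CollectI)
  fix w assume w: "w \<in> W"
  have sub: "convex hull W \<subseteq> cball m r"
    using assms by (intro hull_minimal) auto
  have "w \<notin> open_segment a b" if "a \<in> convex hull W" "b \<in> convex hull W" for a b
  proof
    assume "w \<in> open_segment a b"
    then have "dist m w < dist m a \<or> dist m w < dist m b"
      by (rule dist_decreases_open_segment [rule_format])
    with that sub assms w show False
      by (smt (verit, best) mem_cball mem_sphere subsetD)
  qed
  then show "w extreme_point_of (convex hull W)"
    using w by (simp add: extreme_point_of_def hull_inc)
next
  show "x \<in> W" if "x \<in> {x. x extreme_point_of (convex hull W)}" for x
    using that extreme_point_of_convex_hull by blast
qed

text \<open>The parametrisation of a regular polygon from its centre \<open>m\<close> and an orthonormal frame of its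
  plane. The vertices are numbered by the integers modulo \<open>p\<close>, so that both neighbours of a vertex
  have a number.\<close>
locale polygon_frame =
  fixes p :: nat and r :: real and m e f :: "real ^ 3"
  assumes p: "3 \<le> p" and r: "0 < r"
    and e: "norm e = 1" and f: "norm f = 1" and ef: "e \<bullet> f = 0"
begin

definition vtx :: "int \<Rightarrow> real ^ 3" where
  "vtx j = m + (r * cos (2 * pi * real_of_int j / real p)) *\<^sub>R e
           + (r * sin (2 * pi * real_of_int j / real p)) *\<^sub>R f"

definition side :: real where "side = r * sqrt (2 * (1 - cos (2 * pi / p)))"

lemma norm_frame: "(norm (a *\<^sub>R e + b *\<^sub>R f))\<^sup>2 = a\<^sup>2 + b\<^sup>2"
proof -
  have ee: "e \<bullet> e = 1" "f \<bullet> f = 1" "f \<bullet> e = 0"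
    using e f ef by (simp_all add: dot_square_norm inner_commute)
  show ?thesis
    by (simp add: power2_norm_eq_inner inner_simps ee ef) (simp add: power2_eq_square)
qed

lemma vtx_add_period: "vtx (j + int p * n) = vtx j"
proof -
  have a: "2 * pi * real_of_int (j + int p * n) / real p
      = 2 * pi * real_of_int j / real p + (2 * pi) * real_of_int n"
    using p by (simp add: field_simps)
  show ?thesis
    unfolding vtx_def a cos_add sin_add by simp
qed

lemma vtx_mod: "vtx (j mod int p) = vtx j"
  using vtx_add_period [of "j mod int p" "j div int p"] by (simp only: mod_mult_div_eq)

lemma range_vtx: "range vtx = (\<lambda>j. vtx (int j)) ` {..<p}"
proof
  show "range vtx \<subseteq> (\<lambda>j. vtx (int j)) ` {..<p}"
  proof
    fix x assume "x \<in> range vtx"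
    then obtain j where "x = vtx j" by blast
    then have "x = vtx (int (nat (j mod int p)))" "nat (j mod int p) < p"
      using p vtx_mod [of j] by (auto simp: nat_less_iff)
    then show "x \<in> (\<lambda>j. vtx (int j)) ` {..<p}" by blast
  qed
qed auto

lemma finite_range_vtx: "finite (range vtx)"
  unfolding range_vtx by simp

lemma dist_vtx: "(dist (vtx i) (vtx j))\<^sup>2 = 2 * r\<^sup>2 * (1 - cos (2 * pi * real_of_int (i - j) / p))"
proof -
  let ?a = "2 * pi * real_of_int i / p" and ?b = "2 * pi * real_of_int j / p"
  have "vtx i - vtx j = (r * cos ?a - r * cos ?b) *\<^sub>R e + (r * sin ?a - r * sin ?b) *\<^sub>R f"
    by (simp add: vtx_def algebra_simps)
  then have "(dist (vtx i) (vtx j))\<^sup>2 = (r * cos ?a - r * cos ?b)\<^sup>2 + (r * sin ?a - r * sin ?b)\<^sup>2"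
    by (simp add: dist_norm norm_frame)
  also have "\<dots> = r\<^sup>2 * (((sin ?a)\<^sup>2 + (cos ?a)\<^sup>2) + ((sin ?b)\<^sup>2 + (cos ?b)\<^sup>2)
      - 2 * (cos ?a * cos ?b + sin ?a * sin ?b))"
    by algebra
  also have "cos ?a * cos ?b + sin ?a * sin ?b = cos (?a - ?b)"
    by (simp add: cos_diff)
  also have "?a - ?b = 2 * pi * real_of_int (i - j) / p"
    by (simp add: diff_divide_distrib algebra_simps)
  finally show ?thesis
    unfolding sin_cos_squared_add by simp
qed

lemma vtx_sphere: "range vtx \<subseteq> sphere m r"
proof
  fix x assume "x \<in> range vtx"
  then obtain j where x: "x = vtx j" by blast
  let ?a = "2 * pi * real_of_int j / p"
  have "(dist m x)\<^sup>2 = (norm ((r * cos ?a) *\<^sub>R e + (r * sin ?a) *\<^sub>R f))\<^sup>2"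
    unfolding x vtx_def dist_commute [of m] by (simp add: dist_norm)
  also have "\<dots> = r\<^sup>2 * ((sin ?a)\<^sup>2 + (cos ?a)\<^sup>2)"
    unfolding norm_frame by algebra
  finally have "(dist m x)\<^sup>2 = r\<^sup>2"
    unfolding sin_cos_squared_add by simp
  then have "dist m x = r"
    using r by (simp add: power2_eq_iff_nonneg)
  then show "x \<in> sphere m r" by simp
qed

lemma cos_angle_less_1: "cos (2 * pi / p) < 1"
proof -
  have "cos (2 * pi / p) < cos 0"
    using p by (intro cos_monotone_0_pi) (auto simp: field_simps)
  then show ?thesis by simp
qed

lemma side_power2: "side\<^sup>2 = 2 * r\<^sup>2 * (1 - cos (2 * pi / p))"
  using cos_angle_less_1 by (simp add: side_def power_mult_distrib)

lemma side_pos: "0 < side"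
  using cos_angle_less_1 r by (simp add: side_def)

text \<open>The squared distance of two vertices depends on the cosine of their angle only, and a cosine
  determines its angle up to sign and full turns.\<close>
lemma dist_side: "dist (vtx i) (vtx j) = side \<longleftrightarrow> vtx i = vtx (j + 1) \<or> vtx i = vtx (j - 1)"
proof
  assume "dist (vtx i) (vtx j) = side"
  then have "cos (2 * pi * real_of_int (i - j) / p) = cos (2 * pi / p)"
    using dist_vtx [of i j] side_power2 r by simp
  then obtain n where "n \<in> \<int>" and
      n: "2 * pi * real_of_int (i - j) / p = 2 * pi / p + 2 * n * pi \<or>
          2 * pi * real_of_int (i - j) / p = - (2 * pi / p) + 2 * n * pi"
    unfolding cos_eq by blast
  from \<open>n \<in> \<int>\<close> obtain k where k: "n = real_of_int k" by (auto elim: Ints_cases)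
  have 1: "2 * pi * x / p = 2 * pi / p + 2 * n * pi \<longleftrightarrow> x = 1 + p * n"
       "2 * pi * x / p = - (2 * pi / p) + 2 * n * pi \<longleftrightarrow> x = - 1 + p * n" for x
  proof -
    have "2 * pi * x / p - (2 * pi / p + 2 * n * pi) = 2 * pi * (x - (1 + p * n)) / p"
      "2 * pi * x / p - (- (2 * pi / p) + 2 * n * pi) = 2 * pi * (x - (- 1 + p * n)) / p"
      using p by (simp_all add: field_simps)
    then show "2 * pi * x / p = 2 * pi / p + 2 * n * pi \<longleftrightarrow> x = 1 + p * n"
       "2 * pi * x / p = - (2 * pi / p) + 2 * n * pi \<longleftrightarrow> x = - 1 + p * n"
      using p by (smt (verit) divide_eq_0_iff mult_eq_0_iff pi_neq_zero of_nat_eq_0_iff not_numeral_le_zero)+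
  qed
  have "real_of_int (i - j) = real_of_int (1 + int p * k) \<or>
        real_of_int (i - j) = real_of_int (- 1 + int p * k)"
    using n unfolding 1 by (simp add: k)
  then have "i - j = 1 + int p * k \<or> i - j = - 1 + int p * k"
    by linarith
  then have "i = (j + 1) + int p * k \<or> i = (j - 1) + int p * k"
    by linarith
  then show "vtx i = vtx (j + 1) \<or> vtx i = vtx (j - 1)"
    using vtx_add_period by metis
next
  have "(dist (vtx (j + 1)) (vtx j))\<^sup>2 = side\<^sup>2" "(dist (vtx (j - 1)) (vtx j))\<^sup>2 = side\<^sup>2"
    unfolding dist_vtx side_power2 by simp_all
  then have "dist (vtx (j + 1)) (vtx j) = side" "dist (vtx (j - 1)) (vtx j) = side"
    using side_pos by (simp_all add: power2_eq_iff_nonneg)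
  moreover assume "vtx i = vtx (j + 1) \<or> vtx i = vtx (j - 1)"
  ultimately show "dist (vtx i) (vtx j) = side" by metis
qed

text \<open>The two neighbours are two steps apart, and \<open>p\<close> does not divide \<open>2\<close>.\<close>
lemma vtx_neighbours_distinct: "vtx (j + 1) \<noteq> vtx (j - 1)"
proof
  assume "vtx (j + 1) = vtx (j - 1)"
  then have "cos (2 * pi * 2 / p) = 1"
    using dist_vtx [of "j + 1" "j - 1"] r by simp
  then obtain n :: int where "2 * pi * 2 / p = real_of_int n * 2 * pi"
    unfolding cos_one_2pi_int by auto
  then have "real_of_int 2 = real_of_int (n * int p)"
    using p by (simp add: field_simps)
  then have "2 = n * int p" by linarith
  then have "int p dvd 2" by (metis dvd_triv_right)
  then show False using p zdvd_imp_le by fastforce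
qed

text \<open>Up to reflection the angle between two vertices lies between \<open>2 \<pi> / p\<close> and \<open>\<pi>\<close>, where the
  cosine decreases.\<close>
lemma side_le_dist:
  assumes "vtx i \<noteq> vtx j"
  shows "side \<le> dist (vtx i) (vtx j)"
proof -
  define k where "k = (i - j) mod int p"
  have "vtx i = vtx (j + k)"
    using vtx_add_period [of "j + k" "(i - j) div int p"] by (simp add: k_def algebra_simps)
  then have d: "dist (vtx i) (vtx j) = dist (vtx (j + k)) (vtx j)" by simp
  have k: "0 < k" "k < int p"
  proof -
    show "k < int p" unfolding k_def using p by simp
    have "0 \<le> k" unfolding k_def using p by simp
    moreover have "k \<noteq> 0" using assms \<open>vtx i = vtx (j + k)\<close> by auto
    ultimately show "0 < k" by simp
  qed
  have kp: "real_of_int k \<le> real p - 1" "1 \<le> real_of_int k" using k by linarith+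
  have "cos (2 * pi * real_of_int k / p) \<le> cos (2 * pi / p)"
  proof (cases "2 * real_of_int k \<le> real p")
    case True
    show ?thesis
      by (rule cos_monotone_0_pi_le) (use True p kp in \<open>auto simp: field_simps\<close>)
  next
    case False
    have "cos (2 * pi * real_of_int k / p) = cos (2 * pi * (real p - real_of_int k) / p)"
    proof -
      have "2 * pi * (real p - real_of_int k) / p = 2 * pi - 2 * pi * real_of_int k / p"
        using p by (simp add: field_simps)
      then show ?thesis by (simp add: cos_diff)
    qed
    also have "\<dots> \<le> cos (2 * pi / p)"
    proof (rule cos_monotone_0_pi_le)
      have "2 * pi * 1 / p \<le> 2 * pi * (real p - real_of_int k) / p"
        by (intro divide_right_mono mult_left_mono) (use kp in auto)
      then show "2 * pi / p \<le> 2 * pi * (real p - real_of_int k) / p" by simp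
    qed (use False p kp in \<open>auto simp: field_simps\<close>)
    finally show ?thesis .
  qed
  then have "side\<^sup>2 \<le> (dist (vtx (j + k)) (vtx j))\<^sup>2"
    unfolding dist_vtx side_power2 using r by (simp add: mult_left_mono)
  then show ?thesis
    unfolding d by (rule power2_le_imp_le) simp
qed

text \<open>For four consecutive vertices \<open>a, b, c, d\<close> the chord \<open>ad\<close> is parallel to the side \<open>bc\<close>; the ratio
  of the lengths is \<open>sin (3 x) / sin x = 1 + 2 cos (2 x)\<close> for \<open>x = \<pi> / p\<close>.\<close>
lemma vtx_step:
  "vtx (j + 2) = vtx (j - 1) + (1 + 2 * cos (2 * pi / p)) *\<^sub>R (vtx (j + 1) - vtx j)"
  "vtx (j - 2) = vtx (j + 1) + (1 + 2 * cos (2 * pi / p)) *\<^sub>R (vtx (j - 1) - vtx j)"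
proof -
  define a where "a = 2 * pi * real_of_int j / p"
  define d where "d = 2 * pi / p"
  have i: "2 * pi * real_of_int (j + 2) / p = a + 2 * d" "2 * pi * real_of_int (j - 2) / p = a - 2 * d"
    "2 * pi * real_of_int (j + 1) / p = a + d" "2 * pi * real_of_int (j - 1) / p = a - d"
    by (simp_all add: a_def d_def add_divide_distrib diff_divide_distrib algebra_simps)
  have sd: "sin d * sin d = 1 - cos d * cos d"
    using sin_squared_eq [of d] by (simp add: power2_eq_square)
  have sd': "sin d * (sin d * x) = (1 - cos d * cos d) * x" for x
    by (simp add: mult.assoc [symmetric] sd)
  have c2: "cos (2 * d) = 2 * (cos d * cos d) - 1"
    by (simp add: cos_double_cos power2_eq_square)
  have t: "cos (a + 2 * d) = cos (a - d) + (1 + 2 * cos d) * (cos (a + d) - cos a)"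
    "sin (a + 2 * d) = sin (a - d) + (1 + 2 * cos d) * (sin (a + d) - sin a)"
    "cos (a - 2 * d) = cos (a + d) + (1 + 2 * cos d) * (cos (a - d) - cos a)"
    "sin (a - 2 * d) = sin (a + d) + (1 + 2 * cos d) * (sin (a - d) - sin a)"
    unfolding cos_add sin_add cos_diff sin_diff c2 sin_double
    by (simp_all add: algebra_simps sd sd')
  show "vtx (j + 2) = vtx (j - 1) + (1 + 2 * cos (2 * pi / p)) *\<^sub>R (vtx (j + 1) - vtx j)"
    unfolding vtx_def i a_def [symmetric] d_def [symmetric] t by (simp add: algebra_simps)
  show "vtx (j - 2) = vtx (j + 1) + (1 + 2 * cos (2 * pi / p)) *\<^sub>R (vtx (j - 1) - vtx j)"
    unfolding vtx_def i a_def [symmetric] d_def [symmetric] t by (simp add: algebra_simps)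
qed

lemma neighbours_on_polygon:
  assumes "v \<in> range vtx"
  shows "card {x \<in> range vtx. dist x v = side} = 2"
proof -
  obtain j where v: "v = vtx j" using assms by blast
  have "{x \<in> range vtx. dist x v = side} = {vtx (j + 1), vtx (j - 1)}"
    unfolding v using dist_side by auto
  then show ?thesis using vtx_neighbours_distinct by simp
qed

text \<open>The same in terms of distances alone, without reference to a numbering of the vertices or to a
  direction of travel.\<close>
lemma polygon_step:
  assumes "u \<in> range vtx" "v \<in> range vtx" "w \<in> range vtx" "u \<noteq> w" "dist u v = side" "dist w v = side"
  defines "x \<equiv> u + (1 + 2 * cos (2 * pi / p)) *\<^sub>R (w - v)"
  shows "x \<in> range vtx" "dist x w = side" "x \<noteq> v"
    "(dist u w)\<^sup>2 = (2 + 2 * cos (2 * pi / p)) * side\<^sup>2"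
proof -
  obtain i j k where ijk: "u = vtx i" "v = vtx j" "w = vtx k" using assms by blast
  have d: "2 * r\<^sup>2 * (1 - cos (2 * pi * 2 / p)) = (2 + 2 * cos (2 * pi / p)) * side\<^sup>2"
  proof -
    have "cos (2 * pi * 2 / p) = cos (2 * (2 * pi / p))" by (simp add: mult.commute)
    also have "\<dots> = 2 * (cos (2 * pi / p))\<^sup>2 - 1" by (rule cos_double_cos)
    finally show ?thesis
      unfolding side_power2 by algebra
  qed
  have "u = vtx (j + 1) \<and> w = vtx (j - 1) \<or> u = vtx (j - 1) \<and> w = vtx (j + 1)"
    using assms ijk dist_side by metis
  then consider "u = vtx (j - 1)" "w = vtx (j + 1)" "x = vtx (j + 2)"
    | "u = vtx (j + 1)" "w = vtx (j - 1)" "x = vtx (j - 2)"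
    unfolding x_def ijk(2) by (metis vtx_step)
  then have "x \<in> range vtx \<and> dist x w = side \<and> x \<noteq> v
    \<and> (dist u w)\<^sup>2 = (2 + 2 * cos (2 * pi / p)) * side\<^sup>2"
  proof cases
    case 1
    then show ?thesis
      using dist_side [of "j + 2" "j + 1"] vtx_neighbours_distinct [of "j + 1"] d dist_vtx [of "j - 1" "j + 1"]
      by (simp add: ijk(2) add.commute)
  next
    case 2
    then show ?thesis
      using dist_side [of "j - 2" "j - 1"] vtx_neighbours_distinct [of "j - 1"] d dist_vtx [of "j + 1" "j - 1"]
      by (simp add: ijk(2) add.commute)
  qed
  then show "x \<in> range vtx" "dist x w = side" "x \<noteq> v"
    "(dist u w)\<^sup>2 = (2 + 2 * cos (2 * pi / p)) * side\<^sup>2"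
    by blast+
qed

text \<open>The linear functional that supports the polygon along the side \<open>uv\<close> points from the centre
  to the midpoint of \<open>u\<close> and \<open>v\<close>. Since all vertices have the same distance from the centre, its value at
  a vertex \<open>x\<close> is a decreasing function of \<open>(dist x u)\<^sup>2 + (dist x v)\<^sup>2\<close>. This sum is smallest at
  \<open>x = u\<close> and \<open>x = v\<close>, because no two vertices are closer than the side length.\<close>
lemma side_face:
  assumes "u \<in> range vtx" "v \<in> range vtx" "dist u v = side"
  shows "convex hull {u, v} face_of convex hull (range vtx)"
proof -
  define a where "a = u + v - 2 *\<^sub>R m"
  define b where "b = (4 * r\<^sup>2 - side\<^sup>2) / 2 + a \<bullet> m"
  have nrm: "norm (x - m) = r" if "x \<in> range vtx" for x
    using that vtx_sphere by (auto simp: dist_norm norm_minus_commute)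
  have key: "2 * (b - a \<bullet> x) = (dist x u)\<^sup>2 + (dist x v)\<^sup>2 - side\<^sup>2" if "x \<in> range vtx" for x
  proof -
    have "(dist x u)\<^sup>2 = 2 * r\<^sup>2 - 2 * ((x - m) \<bullet> (u - m))"
      "(dist x v)\<^sup>2 = 2 * r\<^sup>2 - 2 * ((x - m) \<bullet> (v - m))"
      using nrm [OF that] nrm [OF assms(1)] nrm [OF assms(2)]
        dot_norm_neg [of "x - m" "u - m"] dot_norm_neg [of "x - m" "v - m"]
      by (simp_all add: dist_norm)
    moreover have "2 * (b - a \<bullet> x) = 4 * r\<^sup>2 - side\<^sup>2 - 2 * ((x - m) \<bullet> (u - m)) - 2 * ((x - m) \<bullet> (v - m))"
      by (simp add: a_def b_def inner_diff_left inner_diff_right inner_add_left inner_add_right inner_commute field_simps)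
    ultimately show ?thesis by simp
  qed
  have pos: "0 \<le> b - a \<bullet> x" and eq: "a \<bullet> x = b \<longleftrightarrow> x = u \<or> x = v" if x: "x \<in> range vtx" for x
  proof -
    have "0 \<le> b - a \<bullet> x \<and> (a \<bullet> x = b \<longleftrightarrow> x = u \<or> x = v)"
    proof (cases "x = u \<or> x = v")
      case True
      then have "(dist x u)\<^sup>2 + (dist x v)\<^sup>2 = side\<^sup>2"
        using assms(3) by (auto simp: dist_commute)
      then show ?thesis using True key [OF x] by simp
    next
      case False
      then have "side \<le> dist x u" "side \<le> dist x v"
        using x assms side_le_dist by blast+
      then have "side\<^sup>2 \<le> (dist x u)\<^sup>2" "side\<^sup>2 \<le> (dist x v)\<^sup>2"
        using side_pos by (auto intro: power_mono)
      moreover have "0 < side\<^sup>2" using side_pos by simp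
      ultimately have "0 < 2 * (b - a \<bullet> x)"
        unfolding key [OF x] by linarith
      then show ?thesis using False by auto
    qed
    then show "0 \<le> b - a \<bullet> x" "a \<bullet> x = b \<longleftrightarrow> x = u \<or> x = v" by auto
  qed
  let ?F = "convex hull (range vtx)"
  let ?T = "?F \<inter> {x. a \<bullet> x = b}"
  have "?F \<subseteq> {x. a \<bullet> x \<le> b}"
    using pos by (intro hull_minimal) (auto simp: convex_halfspace_le)
  then have T: "?T face_of ?F"
    by (intro face_of_Int_supporting_hyperplane_le) auto
  then obtain S where S: "S \<subseteq> range vtx" "?T = convex hull S"
    using face_of_convex_hull_subset finite_range_vtx finite_imp_compact by metis
  have "S \<subseteq> {u, v}"
    using S eq hull_inc [of _ S convex] by blast
  then have "?T \<subseteq> convex hull {u, v}"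
    unfolding S(2) by (rule hull_mono)
  moreover have "convex hull {u, v} \<subseteq> ?T"
    using assms eq by (intro hull_minimal) (auto simp: hull_inc convex_Int convex_hyperplane)
  ultimately show ?thesis using T by simp
qed

end

lemma regular_polygonE:
  assumes "regular_polygon p r F"
  obtains m e f where "polygon_frame p r e f" "F = convex hull (range (polygon_frame.vtx p r m e f))"
proof -
  from assms obtain m e f where fr: "3 \<le> p" "0 < r" "norm e = 1" "norm f = 1" "e \<bullet> f = 0"
    and F: "F = convex hull ((\<lambda>j. m + (r * cos (2 * pi * real j / real p)) *\<^sub>R e
                  + (r * sin (2 * pi * real j / real p)) *\<^sub>R f) ` {..<p})"
    unfolding regular_polygon_def by blast
  interpret polygon_frame p r m e f using fr by unfold_locales
  have "F = convex hull (range vtx)"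
    unfolding F range_vtx by (simp add: vtx_def)
  then show thesis using that polygon_frame_axioms by blast
qed

section \<open>Facets of a polytope and its vertices\<close>

lemma facet_vertices:
  assumes "regular_polygon p r F" "F facet_of P"
  obtains m e f where "polygon_frame p r e f"
    "F \<inter> vertices P = range (polygon_frame.vtx p r m e f)"
    "F = convex hull (range (polygon_frame.vtx p r m e f))"
proof -
  obtain m e f where fr: "polygon_frame p r e f" and F: "F = convex hull (range (polygon_frame.vtx p r m e f))"
    using regular_polygonE [OF assms(1)] by blast
  have "F \<inter> vertices P = {x. x extreme_point_of F}"
    using extreme_point_of_face [OF facet_of_imp_face_of [OF assms(2)]] by (auto simp: vertices_def)
  also have "\<dots> = range (polygon_frame.vtx p r m e f)"
    unfolding F by (rule convex_hull_sphere_extreme_points [OF polygon_frame.vtx_sphere [OF fr]])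
  finally show thesis using that fr F by blast
qed

lemma vertices_not_collinear:
  assumes "{u, v, w} \<subseteq> vertices P" "convex P" "u \<noteq> v" "v \<noteq> w" "u \<noteq> w"
  shows "\<not> collinear {u, v, w}"
proof
  assume "collinear {u, v, w}"
  then have *: "u \<in> closed_segment v w \<or> v \<in> closed_segment w u \<or> w \<in> closed_segment u v"
    by (simp add: collinear_between_cases between_mem_segment)
  have ext: "x \<notin> open_segment a b" if "x \<in> vertices P" "a \<in> vertices P" "b \<in> vertices P" for x a b
    using that unfolding vertices_def extreme_point_of_def by blast
  have "u \<notin> closed_segment v w" "v \<notin> closed_segment w u" "w \<notin> closed_segment u v"
    using ext [of u v w] ext [of v w u] ext [of w u v] assms unfolding open_segment_def by auto
  with * show False by blast
qed

text \<open>Two distinct facets of a 3-polytope meet in a face of dimension at most one, whereas no three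
  vertices are collinear.\<close>
lemma facet_determined_by_three_vertices:
  assumes "convex P" "F facet_of P" "F' facet_of P"
    and "{u, v, w} \<subseteq> F \<inter> vertices P" "{u, v, w} \<subseteq> F' \<inter> vertices P"
    and ne: "u \<noteq> v" "v \<noteq> w" "u \<noteq> w" and dim: "aff_dim P = 3"
  shows "F = F'"
proof -
  have nc: "\<not> collinear (F \<inter> F')"
    using vertices_not_collinear [of u v w P] assms collinear_subset [of "F \<inter> F'" "{u, v, w}"] by blast
  then have d: "aff_dim (F \<inter> F') \<ge> 2" by (simp add: collinear_aff_dim)
  have "F \<inter> F' = G" if "G facet_of P" "G = F \<or> G = F'" for G
  proof (rule ccontr)
    assume "F \<inter> F' \<noteq> G"
    moreover have G: "G face_of P" "convex G"
      using that facet_of_imp_face_of face_of_imp_convex by blast+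
    moreover have "F \<inter> F' face_of P"
      using assms(2,3) by (intro face_of_Int facet_of_imp_face_of)
    then have "F \<inter> F' face_of G"
      using that(2) unfolding face_of_face [OF G(1)] by auto
    ultimately have "aff_dim (F \<inter> F') < aff_dim G"
      using face_of_aff_dim_lt [OF G(2)] by blast
    moreover have "aff_dim G = 2" using that(1) dim by (simp add: facet_of_def)
    ultimately show False using d by simp
  qed
  then show ?thesis using assms(2,3) by metis
qed

text \<open>A proper face of a polyhedron is the intersection of the facets that contain it.\<close>
lemma edge_in_second_facet:
  assumes P: "polyhedron P" and F: "F facet_of P" and E: "E face_of F" "E \<noteq> {}" "E \<noteq> F"
  obtains F' where "F' facet_of P" "F' \<noteq> F" "E \<subseteq> F'"
proof -
  have FP: "F face_of P" "F \<noteq> P" using F facet_of_imp_face_of by (auto simp: facet_of_def)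
  have EP: "E face_of P" using E(1) FP(1) by (rule face_of_trans)
  have "E \<noteq> P" using E FP face_of_imp_subset by blast
  then have "E = \<Inter>{F'. F' facet_of P \<and> E \<subseteq> F'}"
    using face_of_polyhedron [OF P EP E(2)] by blast
  then show thesis using that E(3) F E(1) face_of_imp_subset by blast
qed

section \<open>Cycles of length at most five\<close>

text \<open>A 2-regular graph without loops or multiple edges is a union of cycles of length at least three, so
  with at most five nodes it is one cycle. The following three lemmas continue a given path
  \<open>a, b, d\<close> of length two to that cycle.\<close>
lemma two_regular_three:
  assumes N: "card N = 3" and irr: "\<And>x. \<not> E x x" and sym: "\<And>x y. E x y \<Longrightarrow> E y x"
    and EN: "\<And>x y. E x y \<Longrightarrow> x \<in> N"
    and ab: "E a b" and bd: "E b d" and ad: "a \<noteq> d"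
    and two: "\<And>x y. E x y \<Longrightarrow> \<exists>z. z \<noteq> y \<and> {w. E x w} = {y, z}"
  shows "E d a"
proof -
  have dist: "a \<noteq> b" "b \<noteq> d" using ab bd irr by auto
  have fin: "finite N" using N card.infinite by fastforce
  have "{a, b, d} = N"
    using fin N dist ad EN [OF ab] EN [OF bd] EN [OF sym [OF bd]]
    by (intro card_subset_eq) auto
  moreover obtain x where "E d x" "x \<noteq> b"
    using two [OF sym [OF bd]] by blast
  ultimately show ?thesis
    using EN [OF sym [OF \<open>E d x\<close>]] irr by auto
qed

lemma two_regular_four:
  assumes N: "card N = 4" and irr: "\<And>x. \<not> E x x" and sym: "\<And>x y. E x y \<Longrightarrow> E y x"
    and EN: "\<And>x y. E x y \<Longrightarrow> x \<in> N"
    and ab: "E a b" and bd: "E b d" and ad: "a \<noteq> d"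
    and two: "\<And>x y. E x y \<Longrightarrow> \<exists>z. z \<noteq> y \<and> {w. E x w} = {y, z}"
    and ne: "\<And>x. x \<in> N \<Longrightarrow> \<exists>y. E x y"
  shows "\<exists>x. E d x \<and> E x a \<and> x \<noteq> b"
proof -
  have dist: "a \<noteq> b" "b \<noteq> d" using ab bd irr by auto
  have fin: "finite N" using N card.infinite by fastforce
  have "card (N - {a, b, d}) = 1"
    using fin N dist ad EN [OF ab] EN [OF bd] EN [OF sym [OF bd]]
    by (subst card_Diff_subset) auto
  then obtain x where x: "N - {a, b, d} = {x}" by (auto simp: card_1_singleton_iff)
  have nb: "{w. E b w} = {a, d}"
    using two [OF bd] sym [OF ab] ad by auto
  have N': "N = {a, b, d, x}" and xN: "x \<in> N" and xb: "x \<noteq> a" "x \<noteq> d" "x \<noteq> b"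
    using x EN [OF ab] EN [OF bd] EN [OF sym [OF bd]] by auto
  have sub: "w = a \<or> w = d" if w: "E x w" for w
  proof -
    have "w \<noteq> b" using nb sym [OF w] xb by blast
    moreover have "w \<noteq> x" using w irr by blast
    ultimately show ?thesis using EN [OF sym [OF w]] unfolding N' by blast
  qed
  obtain y where y: "E x y" using ne [OF xN] by blast
  obtain z where z: "E x z" "z \<noteq> y" using two [OF y] by blast
  have "E x a" "E x d" using sub [OF y] sub [OF z(1)] y z by auto
  then show ?thesis using sym xb by blast
qed

lemma two_regular_five:
  assumes N: "card N = 5" and irr: "\<And>x. \<not> E x x" and sym: "\<And>x y. E x y \<Longrightarrow> E y x"
    and EN: "\<And>x y. E x y \<Longrightarrow> x \<in> N"
    and ab: "E a b" and bd: "E b d" and ad: "a \<noteq> d"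
    and two: "\<And>x y. E x y \<Longrightarrow> \<exists>z. z \<noteq> y \<and> {w. E x w} = {y, z}"
    and ne: "\<And>x. x \<in> N \<Longrightarrow> \<exists>y. E x y"
  shows "\<exists>x y. E d x \<and> E x y \<and> E y a \<and> x \<noteq> b \<and> y \<noteq> d \<and> x \<noteq> a \<and> y \<noteq> b"
proof -
  have dist: "a \<noteq> b" "b \<noteq> d" using ab bd irr by auto
  have fin: "finite N" using N card.infinite by fastforce
  have "card (N - {a, b, d}) = 2"
    using fin N dist ad EN [OF ab] EN [OF bd] EN [OF sym [OF bd]]
    by (subst card_Diff_subset) auto
  then obtain x y where xy: "N - {a, b, d} = {x, y}" "x \<noteq> y" by (auto simp: card_2_iff)
  have nb: "{w. E b w} = {a, d}"
    using two [OF bd] sym [OF ab] ad by auto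
  have Nxy: "N = {a, b, d, x, y}"
    using xy EN [OF ab] EN [OF bd] EN [OF sym [OF bd]] by blast
  have xay: "x \<noteq> a" "x \<noteq> b" "x \<noteq> d" "y \<noteq> a" "y \<noteq> b" "y \<noteq> d" using xy by auto
  have nxb: "\<not> E x b" "\<not> E y b"
    using nb sym xay by blast+
  have subx: "w = a \<or> w = d \<or> w = y" if "E x w" for w
    using EN [OF sym [OF that]] that irr nxb unfolding Nxy by blast
  have suby: "w = a \<or> w = d \<or> w = x" if "E y w" for w
    using EN [OF sym [OF that]] that irr nxb unfolding Nxy by blast
  have two': "\<exists>z z'. z \<noteq> z' \<and> E t z \<and> E t z'" if t: "t \<in> N" for t
  proof -
    obtain z where "E t z" using ne [OF t] by blast
    with two [OF this] show ?thesis by blast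
  qed
  have in_N: "x \<in> N" "y \<in> N"
    unfolding Nxy by simp_all
  have cx: "E x a \<and> E x d \<or> E x a \<and> E x y \<or> E x d \<and> E x y"
    using two' [OF in_N(1)] subx by metis
  have cy: "E y a \<and> E y d \<or> E y a \<and> E y x \<or> E y d \<and> E y x"
    using two' [OF in_N(2)] suby by metis
  have le2: "\<not> (E t t1 \<and> E t t2 \<and> E t t3)" if "t1 \<noteq> t2" "t1 \<noteq> t3" "t2 \<noteq> t3" for t t1 t2 t3
  proof
    assume E: "E t t1 \<and> E t t2 \<and> E t t3"
    then obtain z where "{w. E t w} = {t1, z}" using two by blast
    with E have "t2 \<in> {t1, z}" "t3 \<in> {t1, z}" by blast+
    with that show False by auto
  qed
  have 1: "\<not> (E a x \<and> E a y)"
    using le2 [of b x y a] ab xay xy(2) by blast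
  have 2: "\<not> (E d x \<and> E d y)"
    using le2 [of b x y d] sym [OF bd] xay xy(2) by blast
  have s: "E x a = E a x" "E x d = E d x" "E y a = E a y" "E y d = E d y" "E x y = E y x"
    using sym by blast+
  have "E d x \<and> E x y \<and> E y a \<or> E d y \<and> E y x \<and> E x a"
    using cx cy 1 2 unfolding s by blast
  then show ?thesis using xay by blast
qed

section \<open>Corners and vertex figures\<close>

text \<open>This is the only place where the dimension of the space enters the metric part of the argument.\<close>
lemma orthogonal_to_three:
  fixes y :: "real ^ 3"
  assumes "a \<bullet> b = 0" "a \<bullet> d = 0" "b \<bullet> d = 0" "a \<noteq> 0" "b \<noteq> 0" "d \<noteq> 0"
    and "y \<bullet> a = 0" "y \<bullet> b = 0" "y \<bullet> d = 0"
  shows "y = 0"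
proof (rule ccontr)
  assume y: "y \<noteq> 0"
  have ne: "a \<noteq> b" "a \<noteq> d" "b \<noteq> d" "y \<noteq> a" "y \<noteq> b" "y \<noteq> d"
    using assms y by auto
  have "independent {a, b, d, y}"
    using assms y
    by (intro pairwise_orthogonal_independent)
       (auto simp: pairwise_def orthogonal_def inner_commute)
  then have "card {a, b, d, y} \<le> 3"
    using independent_bound by fastforce
  then show False using ne by auto
qed

text \<open>The properties of a regular polyhedron inscribed in a unit sphere with centre \<open>c\<close> that the
  metric argument uses. \<open>V\<close> is the set of vertices, \<open>FF\<close> consists of the vertex sets of the facets, \<open>s\<close>
  is the length of an edge, \<open>q\<close> is the number of facets at a vertex, and
  \<open>x - u = \<kappa> (w - v)\<close> for four consecutive vertices \<open>u, v, w, x\<close> of a facet. Thus \<open>\<kappa>\<close> is \<open>0\<close> for triangles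
  and \<open>1\<close> for squares. Adjacency in a facet is expressed by the distance
  \<open>s\<close>.\<close>
locale regular_facets =
  fixes V :: "(real ^ 3) set" and FF :: "(real ^ 3) set set" and c :: "real ^ 3"
    and s \<kappa> :: real and q :: nat
  assumes finV: "finite V" and neV: "V \<noteq> {}" and sphereV: "V \<subseteq> sphere c 1"
    and full: "\<And>n b. n \<noteq> 0 \<Longrightarrow> \<exists>x\<in>V. n \<bullet> x \<noteq> b"
    and finFF: "finite FF" and FFV: "\<And>W. W \<in> FF \<Longrightarrow> W \<subseteq> V"
    and s_pos: "0 < s"
    and facet_degree: "\<And>v. v \<in> V \<Longrightarrow> card {W \<in> FF. v \<in> W} = q" and q: "q > 0"
    and two_neighbours: "\<And>W v. W \<in> FF \<Longrightarrow> v \<in> W \<Longrightarrow> card {x \<in> W. dist x v = s} = 2"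
    and facet_step: "\<And>W u v w. W \<in> FF \<Longrightarrow> u \<in> W \<Longrightarrow> v \<in> W \<Longrightarrow> w \<in> W \<Longrightarrow> u \<noteq> w \<Longrightarrow>
      dist u v = s \<Longrightarrow> dist w v = s \<Longrightarrow>
      (dist u w)\<^sup>2 = (1 + \<kappa>) * s\<^sup>2 \<and> u + \<kappa> *\<^sub>R (w - v) \<in> W \<and>
      dist (u + \<kappa> *\<^sub>R (w - v)) w = s \<and> u + \<kappa> *\<^sub>R (w - v) \<noteq> v"
    and edge_shared: "\<And>W u v. W \<in> FF \<Longrightarrow> u \<in> W \<Longrightarrow> v \<in> W \<Longrightarrow> dist u v = s \<Longrightarrow>
      \<exists>W'\<in>FF. W' \<noteq> W \<and> u \<in> W' \<and> v \<in> W'"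
    and facet_unique: "\<And>W W' u v w. W \<in> FF \<Longrightarrow> W' \<in> FF \<Longrightarrow> {u, v, w} \<subseteq> W \<Longrightarrow> {u, v, w} \<subseteq> W' \<Longrightarrow>
      u \<noteq> v \<Longrightarrow> v \<noteq> w \<Longrightarrow> u \<noteq> w \<Longrightarrow> W = W'"
    and facet_support: "\<And>W. W \<in> FF \<Longrightarrow> \<exists>n b. n \<noteq> 0 \<and> (\<forall>x\<in>W. n \<bullet> x = b) \<and> (\<forall>x\<in>V. n \<bullet> x \<le> b)"
begin

definition U :: "(real ^ 3) set" where "U = {x. c + x \<in> V}"

definition corner :: "real ^ 3 \<Rightarrow> real ^ 3 \<Rightarrow> real ^ 3 \<Rightarrow> bool" where
  "corner u v w \<longleftrightarrow> u \<noteq> w \<and> dist u v = s \<and> dist w v = s \<and>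
     (\<exists>W\<in>FF. c + u \<in> W \<and> c + v \<in> W \<and> c + w \<in> W)"

definition \<alpha> :: real where "\<alpha> = 1 - s\<^sup>2 / 2"

text \<open>For a vertex figure that is a regular polygon, \<open>g\<close> is twice the cosine of the angle between the
  directions from its centre to consecutive vertices.\<close>
definition g :: real where "g = 2 - 2 * (1 + \<kappa>) / (1 + \<alpha>)"

lemma dist_c [simp]: "dist (c + u) (c + v) = dist u v"
  by (simp add: dist_norm)

lemma U_eq: "U = (\<lambda>x. x - c) ` V"
  unfolding U_def by (force simp: image_iff)

lemma finite_U: "finite U" using finV by (simp add: U_eq)

lemma U_norm: "x \<in> U \<Longrightarrow> norm x = 1"
  using sphereV by (auto simp: U_def dist_norm)

lemma U_inner: "x \<in> U \<Longrightarrow> x \<bullet> x = 1"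
  using U_norm by (simp add: dot_square_norm)

lemma U_dist: "x \<in> U \<Longrightarrow> y \<in> U \<Longrightarrow> x \<bullet> y = 1 - (dist x y)\<^sup>2 / 2"
  using dot_norm_neg [of x y] by (simp add: dist_norm U_norm field_simps)

lemma corner_sym: "corner u v w \<Longrightarrow> corner w v u"
  unfolding corner_def by blast

lemma corner_U: assumes "corner u v w" shows "u \<in> U" "v \<in> U" "w \<in> U"
  using assms FFV unfolding corner_def U_def by blast+

lemma corner_neq: "corner u v w \<Longrightarrow> u \<noteq> w \<and> u \<noteq> v \<and> v \<noteq> w"
  using s_pos unfolding corner_def by auto

lemma corner_step: assumes "corner u v w" shows "corner v w (u + \<kappa> *\<^sub>R (w - v))"
proof -
  obtain W where W: "W \<in> FF" "c + u \<in> W" "c + v \<in> W" "c + w \<in> W"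
    and d: "u \<noteq> w" "dist u v = s" "dist w v = s"
    using assms unfolding corner_def by blast
  have "(c + u) + \<kappa> *\<^sub>R ((c + w) - (c + v)) = c + (u + \<kappa> *\<^sub>R (w - v))" by simp
  then show ?thesis
    using facet_step [OF W] d W unfolding corner_def
    by (metis add_left_cancel dist_c dist_commute)
qed

lemma corner_inner: assumes "corner u v w"
  shows "u \<bullet> v = \<alpha>" "v \<bullet> w = \<alpha>" "u \<bullet> w = 1 - (1 + \<kappa>) * (1 - \<alpha>)" "v \<bullet> u = \<alpha>" "w \<bullet> v = \<alpha>"
    "w \<bullet> u = 1 - (1 + \<kappa>) * (1 - \<alpha>)"
proof -
  obtain W where W: "W \<in> FF" "c + u \<in> W" "c + v \<in> W" "c + w \<in> W"
    and d: "u \<noteq> w" "dist u v = s" "dist w v = s"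
    using assms unfolding corner_def by blast
  have "(dist u w)\<^sup>2 = (1 + \<kappa>) * s\<^sup>2"
    using facet_step [OF W] d by simp
  then show "u \<bullet> v = \<alpha>" "v \<bullet> w = \<alpha>" "u \<bullet> w = 1 - (1 + \<kappa>) * (1 - \<alpha>)"
    using d corner_U [OF assms] by (simp_all add: U_dist \<alpha>_def dist_commute)
  then show "v \<bullet> u = \<alpha>" "w \<bullet> v = \<alpha>" "w \<bullet> u = 1 - (1 + \<kappa>) * (1 - \<alpha>)"
    by (simp_all add: inner_commute)
qed

lemma facet_corner:
  assumes "W \<in> FF" "c + u \<in> W" "c + v \<in> W" "dist u v = s"
  obtains w where "corner u v w" "c + w \<in> W"
proof -
  have "card {x \<in> W. dist x (c + v) = s} = 2"
    using assms two_neighbours by blast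
  then obtain a b where ab: "a \<noteq> b" "{x \<in> W. dist x (c + v) = s} = {a, b}"
    by (auto simp: card_2_iff)
  have "c + u \<in> {x \<in> W. dist x (c + v) = s}" using assms by simp
  then obtain x where x: "x \<in> W" "dist x (c + v) = s" "x \<noteq> c + u"
    using ab by blast
  have "corner u v (x - c)"
    using x assms unfolding corner_def by (auto simp: dist_norm diff_diff_eq)
  then show thesis using that [of "x - c"] x by simp
qed

lemma corner_exists: assumes "v \<in> U" obtains u w where "corner u v w"
proof -
  have "card {W \<in> FF. c + v \<in> W} > 0" using facet_degree q assms by (simp add: U_def)
  then obtain W where W: "W \<in> FF" "c + v \<in> W" by (auto simp: card_gt_0_iff)
  then have "card {x \<in> W. dist x (c + v) = s} = 2" using two_neighbours by blast
  then obtain x where x: "x \<in> W" "dist x (c + v) = s" by (fastforce simp: card_2_iff)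
  have "dist (x - c) v = s" using x by (simp add: dist_norm diff_diff_eq)
  with W x obtain w where "corner (x - c) v w"
    using facet_corner [of W "x - c" v] by auto
  then show thesis by (rule that)
qed

lemma corner_other: assumes "corner u v w" obtains w' where "w' \<noteq> w" "corner u v w'"
proof -
  obtain W where W: "W \<in> FF" "c + u \<in> W" "c + v \<in> W" "c + w \<in> W"
    and d: "u \<noteq> w" "dist u v = s" "dist w v = s"
    using assms unfolding corner_def by blast
  obtain W' where W': "W' \<in> FF" "W' \<noteq> W" "c + u \<in> W'" "c + v \<in> W'"
    using edge_shared [OF W(1-3)] d by auto
  obtain w' where w': "corner u v w'" "c + w' \<in> W'"
    using facet_corner [OF W'(1,3,4)] d by blast
  have "w' \<noteq> w"
    using facet_unique [OF W(1) W'(1), of "c + u" "c + v" "c + w"] W W' w'(2)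
      corner_neq [OF assms] by auto
  then show thesis using that w' by blast
qed

lemma alpha_less: "\<alpha> < 1" using s_pos by (simp add: \<alpha>_def)

text \<open>If adjacent vertices were antipodal, both neighbours of a vertex in a facet would be its
  antipode.\<close>
lemma alpha_gt: assumes "corner u v w" shows "- 1 < \<alpha>"
proof (rule ccontr)
  assume "\<not> - 1 < \<alpha>"
  moreover have u: "norm u = 1" "norm v = 1" "norm w = 1" using corner_U [OF assms] U_norm by auto
  moreover have "- 1 \<le> \<alpha>"
    using Cauchy_Schwarz_ineq2 [of u v] corner_inner [OF assms] u by simp
  ultimately have a: "\<alpha> = - 1" by simp
  have "u + v = 0" "w + v = 0"
  proof -
    have "(u + v) \<bullet> (u + v) = 0" "(w + v) \<bullet> (w + v) = 0"
      using corner_inner [OF assms] U_inner corner_U [OF assms] a by (simp_all add: inner_simps)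
    then show "u + v = 0" "w + v = 0" by simp_all
  qed
  then have "u = w" by (metis add_right_cancel)
  then show False using corner_neq [OF assms] by blast
qed

text \<open>The vectors \<open>w\<close> and \<open>w'\<close> have the same norm and the same inner products with \<open>u\<close> and \<open>v\<close>. Hence
  \<open>w - w'\<close> is orthogonal to \<open>u\<close>, \<open>v\<close> and \<open>w + w'\<close>, so that in dimension three \<open>w + w'\<close> lies in the
  span of \<open>u\<close> and \<open>v\<close>. The inner products with \<open>u\<close> and \<open>v\<close> give the coefficients.\<close>
lemma corner_reflect:
  assumes "corner u v w" "corner u v w'" "w \<noteq> w'"
  shows "w' = g *\<^sub>R u + ((2 - g) * \<alpha>) *\<^sub>R v - w"
proof -
  define y where "y = w + w' - g *\<^sub>R u - ((2 - g) * \<alpha>) *\<^sub>R v"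
  note i = corner_inner [OF assms(1)] corner_inner [OF assms(2)]
  have n: "u \<bullet> u = 1" "v \<bullet> v = 1" "w \<bullet> w = 1" "w' \<bullet> w' = 1"
    using corner_U [OF assms(1)] corner_U [OF assms(2)] U_inner by auto
  have a: "1 + \<alpha> \<noteq> 0" using alpha_gt [OF assms(1)] by simp
  have gg: "(2 - g) * (1 + \<alpha>) = 2 * (1 + \<kappa>)"
    using a by (simp add: g_def)
  have gg': "2 - 2 * ((1 + \<kappa>) * (1 - \<alpha>)) = g + (2 - g) * \<alpha> * \<alpha>"
    using gg by algebra
  have "y = 0"
  proof (rule orthogonal_to_three)
    \<comment> \<open>an orthogonal basis adapted to the plane of \<open>u\<close> and \<open>v\<close> and the direction \<open>w - w'\<close>\<close>
    show "v \<bullet> (u - \<alpha> *\<^sub>R v) = 0" "v \<bullet> (w - w') = 0" "(u - \<alpha> *\<^sub>R v) \<bullet> (w - w') = 0"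
      by (simp_all add: inner_simps i n)
    show "v \<noteq> 0" using n by auto
    show "u - \<alpha> *\<^sub>R v \<noteq> 0"
    proof
      assume "u - \<alpha> *\<^sub>R v = 0"
      then have "u \<bullet> (u - \<alpha> *\<^sub>R v) = 0" by simp
      then have "\<alpha> * \<alpha> = 1" by (simp add: inner_simps i n)
      then show False
        using alpha_gt [OF assms(1)] alpha_less by (metis abs_square_eq_1 abs_less_iff neg_less_iff_less minus_less_iff power2_eq_square less_irrefl)
    qed
    show "w - w' \<noteq> 0" using assms by simp
    have yv: "y \<bullet> v = 0"
      by (simp add: y_def inner_simps i n algebra_simps)
    have yu: "y \<bullet> u = 0"
      using gg' by (simp add: y_def inner_simps i n)
    show "y \<bullet> v = 0" "y \<bullet> (u - \<alpha> *\<^sub>R v) = 0" using yv yu by (simp_all add: inner_simps)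
    show "y \<bullet> (w - w') = 0"
      by (simp add: y_def inner_simps i n inner_commute)
  qed
  then show ?thesis by (simp add: y_def algebra_simps)
qed

lemma corner_two: assumes "corner u v w"
  shows "\<exists>w'. w' \<noteq> w \<and> {x. corner u v x} = {w, w'}"
proof -
  obtain w' where w': "w' \<noteq> w" "corner u v w'" using corner_other assms by blast
  have "x = w'" if "corner u v x" "x \<noteq> w" for x
    using corner_reflect [OF assms that(1)] corner_reflect [OF assms w'(2)] that w' by simp
  then show ?thesis using w' assms by blast
qed

definition nbrs :: "real ^ 3 \<Rightarrow> (real ^ 3) set" where "nbrs v = {u. \<exists>w. corner u v w}"

text \<open>Every facet at \<open>v\<close> contains two neighbours of \<open>v\<close>, and every edge at \<open>v\<close> lies in two
  facets, since the two corners on it determine their facets.\<close>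
lemma card_nbrs: assumes v: "v \<in> U" shows "card (nbrs v) = q"
proof -
  define S where "S = {W \<in> FF. c + v \<in> W}"
  have fS: "finite S" using finFF by (simp add: S_def)
  have fN: "finite (nbrs v)"
    using finite_U by (rule finite_subset [rotated]) (use corner_U(1) in \<open>auto simp: nbrs_def\<close>)
  have 1: "card {u \<in> nbrs v. c + u \<in> W \<and> dist u v = s} = 2" if "W \<in> S" for W
  proof -
    have "{u \<in> nbrs v. c + u \<in> W \<and> dist u v = s} = (\<lambda>x. x - c) ` {x \<in> W. dist x (c + v) = s}"
    proof (intro equalityI subsetI)
      fix x assume "x \<in> (\<lambda>x. x - c) ` {x \<in> W. dist x (c + v) = s}"
      then have x: "c + x \<in> W" "dist x v = s" by (auto simp: dist_norm diff_diff_eq)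
      have "W \<in> FF" "c + v \<in> W" using that by (simp_all add: S_def)
      with x obtain w where "corner x v w" using facet_corner [of W x v] by blast
      then show "x \<in> {u \<in> nbrs v. c + u \<in> W \<and> dist u v = s}"
        using x by (auto simp: nbrs_def)
    next
      fix u assume "u \<in> {u \<in> nbrs v. c + u \<in> W \<and> dist u v = s}"
      then have "c + u \<in> {x \<in> W. dist x (c + v) = s}" by simp
      then show "u \<in> (\<lambda>x. x - c) ` {x \<in> W. dist x (c + v) = s}"
        by (rule rev_image_eqI) simp
    qed
    then show ?thesis
      using two_neighbours [of W "c + v"] that by (simp add: S_def card_image)
  qed
  have 2: "card {W \<in> S. c + u \<in> W \<and> dist u v = s} = 2" if u: "u \<in> nbrs v" for u
  proof -
    obtain w where w: "corner u v w" using u by (auto simp: nbrs_def)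
    obtain w' where w': "w' \<noteq> w" "{x. corner u v x} = {w, w'}" using corner_two [OF w] by blast
    have cw': "corner u v w'" using w' by blast
    have d: "dist u v = s" using w by (simp add: corner_def)
    obtain W where W: "W \<in> FF" "c + u \<in> W" "c + v \<in> W" "c + w \<in> W" using w corner_def by blast
    obtain W' where W': "W' \<in> FF" "c + u \<in> W'" "c + v \<in> W'" "c + w' \<in> W'" using cw' corner_def by blast
    have n: "c + u \<noteq> c + v" "c + v \<noteq> c + w" "c + u \<noteq> c + w" "c + v \<noteq> c + w'" "c + u \<noteq> c + w'"
      using corner_neq [OF w] corner_neq [OF cw'] by auto
    have "W \<noteq> W'"
    proof
      assume "W = W'"
      then have "{c + u, c + w, c + w'} \<subseteq> {x \<in> W. dist x (c + v) = s}"
        using W W' w cw' by (auto simp: corner_def)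
      moreover have "finite {x \<in> W. dist x (c + v) = s}"
        using finV FFV W(1) by (auto intro: finite_subset)
      ultimately have "card {c + u, c + w, c + w'} \<le> card {x \<in> W. dist x (c + v) = s}"
        by (rule card_mono [rotated])
      then show False
        using two_neighbours [OF W(1,3)] n w'(1) by simp
    qed
    moreover have "{X \<in> S. c + u \<in> X \<and> dist u v = s} = {W, W'}"
    proof (intro equalityI subsetI)
      fix X assume "X \<in> {X \<in> S. c + u \<in> X \<and> dist u v = s}"
      then have X: "X \<in> FF" "c + v \<in> X" "c + u \<in> X" by (auto simp: S_def)
      obtain x where x: "corner u v x" "c + x \<in> X" using facet_corner X d by blast
      then have "x = w \<or> x = w'" using w' by blast
      then show "X \<in> {W, W'}"
        using facet_unique [OF X(1) W(1), of "c + u" "c + v" "c + w"]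
          facet_unique [OF X(1) W'(1), of "c + u" "c + v" "c + w'"] X x W W' n by auto
    qed (use W W' d in \<open>auto simp: S_def\<close>)
    ultimately show ?thesis by simp
  qed
  have "(\<Sum>W\<in>S. card {u \<in> nbrs v. c + u \<in> W \<and> dist u v = s}) = 2 * card (nbrs v)"
    using fS fN 2 by (intro sum_multicount) auto
  moreover have "(\<Sum>W\<in>S. card {u \<in> nbrs v. c + u \<in> W \<and> dist u v = s}) = 2 * card S"
    using 1 by simp
  moreover have "card S = q" using facet_degree v by (simp add: S_def U_def)
  ultimately show ?thesis by simp
qed

lemma corner_irrefl: "\<not> corner u v u" by (simp add: corner_def)

lemma corner_nbrs: "corner u v w \<Longrightarrow> u \<in> nbrs v" by (auto simp: nbrs_def)

lemma nbrs_corner: "u \<in> nbrs v \<Longrightarrow> \<exists>w. corner u v w" by (auto simp: nbrs_def)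

abbreviation "ax \<equiv> (2 - g) * \<alpha>"

lemma corner_chain:
  assumes "corner a v b" "corner b v d" "a \<noteq> d"
  shows "d = g *\<^sub>R b + ax *\<^sub>R v - a"
  using corner_reflect [OF corner_sym [OF assms(1)] assms(2)] assms(3) by blast

text \<open>In the next three lemmas \<open>corner_chain\<close> is applied round the cycle of neighbours of \<open>v\<close>; the
  cycle closes only for special values of \<open>g\<close>.\<close>
lemma degree3: assumes "q = 3" "corner u v w"
  shows "g = - 1" "corner w v ((3 * \<alpha>) *\<^sub>R v - u - w)"
proof -
  obtain d where d: "d \<noteq> u" "corner w v d" using corner_other [OF corner_sym [OF assms(2)]] by blast
  have c: "card (nbrs v) = 3" using card_nbrs corner_U assms by simp
  have du: "corner d v u"
    by (rule two_regular_three [where N = "nbrs v" and E = "\<lambda>x y. corner x v y" and a = u and b = w])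
       (fact c assms(2) d(1) [symmetric] d(2) corner_irrefl corner_sym corner_nbrs corner_two)+
  have 1: "d = g *\<^sub>R w + ax *\<^sub>R v - u" using corner_chain assms(2) d by blast
  have 2: "u = g *\<^sub>R d + ax *\<^sub>R v - w" using corner_chain [OF d(2) du] corner_neq assms(2) by blast
  have "d - u = g *\<^sub>R (w - d) - (u - w)" by (subst 1, subst 2) (simp add: algebra_simps)
  then have "(1 + g) *\<^sub>R (d - w) = 0" by (simp add: algebra_simps)
  moreover have "d \<noteq> w" using corner_neq d by blast
  ultimately show g: "g = - 1" by (simp add: add_eq_0_iff)
  show "corner w v ((3 * \<alpha>) *\<^sub>R v - u - w)"
    using d(2) 1 g by (simp add: algebra_simps)
qed

lemma degree4: assumes "q = 4" "corner u v w" shows "g = 0"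
proof -
  obtain d where d: "d \<noteq> u" "corner w v d" using corner_other [OF corner_sym [OF assms(2)]] by blast
  have c: "card (nbrs v) = 4" using card_nbrs corner_U assms by simp
  obtain x where x: "corner d v x" "corner x v u" "x \<noteq> w"
  proof -
    have "\<exists>x. corner d v x \<and> corner x v u \<and> x \<noteq> w"
      by (rule two_regular_four [where N = "nbrs v" and E = "\<lambda>x y. corner x v y" and a = u and b = w])
         (fact c assms(2) d(1) [symmetric] d(2) corner_irrefl corner_sym corner_nbrs corner_two nbrs_corner)+
    then show thesis using that by blast
  qed
  have 1: "x = g *\<^sub>R d + ax *\<^sub>R v - w" using corner_chain [OF d(2) x(1)] x(3) by blast
  have 2: "w = g *\<^sub>R u + ax *\<^sub>R v - x" using corner_chain [OF x(2) assms(2)] x(3) by blast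
  have "g *\<^sub>R (d - u) = (g *\<^sub>R d + ax *\<^sub>R v - w) - (g *\<^sub>R u + ax *\<^sub>R v - x) + w - x"
    by (simp add: algebra_simps)
  also have "\<dots> = 0" unfolding 1 [symmetric] 2 [symmetric] by simp
  finally show ?thesis using d by simp
qed

lemma degree5: assumes "q = 5" "corner u v w" shows "g\<^sup>2 + g = 1"
proof -
  obtain d where d: "d \<noteq> u" "corner w v d" using corner_other [OF corner_sym [OF assms(2)]] by blast
  have c: "card (nbrs v) = 5" using card_nbrs corner_U assms by simp
  obtain x y where x: "corner d v x" "corner x v y" "corner y v u" "x \<noteq> w" "y \<noteq> d" "x \<noteq> u" "y \<noteq> w"
  proof -
    have "\<exists>x y. corner d v x \<and> corner x v y \<and> corner y v u \<and> x \<noteq> w \<and> y \<noteq> d \<and> x \<noteq> u \<and> y \<noteq> w"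
      by (rule two_regular_five [where N = "nbrs v" and E = "\<lambda>x y. corner x v y" and a = u and b = w])
         (fact c assms(2) d(1) [symmetric] d(2) corner_irrefl corner_sym corner_nbrs corner_two nbrs_corner)+
    then show thesis using that by blast
  qed
  have 0: "d = g *\<^sub>R w + ax *\<^sub>R v - u" using corner_chain [OF assms(2) d(2)] d by blast
  have 1: "x = g *\<^sub>R d + ax *\<^sub>R v - w" using corner_chain [OF d(2) x(1)] x by blast
  have 2: "x = g *\<^sub>R y + ax *\<^sub>R v - u" using corner_chain [OF corner_sym [OF x(3)] corner_sym [OF x(2)]] x by blast
  have 3: "y = g *\<^sub>R u + ax *\<^sub>R v - w" using corner_chain [OF corner_sym [OF assms(2)] corner_sym [OF x(3)]] x by blast
  have "(g\<^sup>2 + g - 1) *\<^sub>R (w - u) = (g *\<^sub>R d + ax *\<^sub>R v - w) - (g *\<^sub>R y + ax *\<^sub>R v - u)"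
    unfolding 0 3 by (simp add: algebra_simps power2_eq_square)
  also have "\<dots> = 0" unfolding 1 [symmetric] 2 [symmetric] by simp
  finally have "g\<^sup>2 + g - 1 = 0 \<or> w - u = 0" by (simp only: scaleR_eq_0_iff)
  moreover have "w - u \<noteq> 0" using corner_neq [OF assms(2)] by auto
  ultimately show ?thesis by linarith
qed

lemma alpha_eq: assumes "corner u v w" shows "(2 - g) * (1 + \<alpha>) = 2 * (1 + \<kappa>)"
proof -
  have "1 + \<alpha> \<noteq> 0" using alpha_gt [OF assms] by simp
  then show ?thesis by (simp add: g_def)
qed

section \<open>Central symmetry\<close>

lemma neU: "U \<noteq> {}" using neV by (simp add: U_eq)

lemma corner_starting_at: assumes "x \<in> U" obtains v w where "corner x v w"
  using corner_exists [OF assms] corner_step by metis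

lemma corner_support:
  assumes "corner u v w"
  obtains n b where "n \<noteq> 0" "n \<bullet> u = b" "n \<bullet> v = b" "n \<bullet> w = b" "\<And>x. x \<in> U \<Longrightarrow> n \<bullet> x \<le> b"
proof -
  obtain W where W: "W \<in> FF" "c + u \<in> W" "c + v \<in> W" "c + w \<in> W"
    using assms unfolding corner_def by blast
  obtain n b where n: "n \<noteq> 0" "\<forall>x\<in>W. n \<bullet> x = b" "\<forall>x\<in>V. n \<bullet> x \<le> b"
    using facet_support [OF W(1)] by blast
  show thesis
  proof (rule that)
    show "n \<noteq> 0" by fact
    show "n \<bullet> u = b - n \<bullet> c" "n \<bullet> v = b - n \<bullet> c" "n \<bullet> w = b - n \<bullet> c"
      using n(2) W by (auto simp: inner_add_right)
    show "n \<bullet> x \<le> b - n \<bullet> c" if "x \<in> U" for x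
      using n(3) that by (auto simp: U_def inner_add_right algebra_simps)
  qed
qed

lemma full_U: assumes "n \<noteq> 0" shows "\<exists>x\<in>U. n \<bullet> x \<noteq> 0"
proof -
  obtain y where "y \<in> V" "n \<bullet> y \<noteq> n \<bullet> c" using full [OF assms] by blast
  then have "y - c \<in> U" "n \<bullet> (y - c) \<noteq> 0" by (auto simp: U_def inner_diff_right)
  then show ?thesis by blast
qed

text \<open>Central symmetry puts the polyhedron between the plane of a facet and the opposite plane. If
  the plane of the facet passed through the centre, it would contain all vertices, so the functional can be
  scaled to be \<open>1\<close> on the facet.\<close>
lemma corner_support_antipodal:
  assumes anti: "\<And>x. x \<in> U \<Longrightarrow> - x \<in> U" and uvw: "corner u v w"
  obtains n where "n \<bullet> u = 1" "n \<bullet> v = 1" "n \<bullet> w = 1" "\<And>x. x \<in> U \<Longrightarrow> \<bar>n \<bullet> x\<bar> \<le> 1"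
proof -
  obtain n b where n: "n \<noteq> 0" "n \<bullet> u = b" "n \<bullet> v = b" "n \<bullet> w = b" "\<And>x. x \<in> U \<Longrightarrow> n \<bullet> x \<le> b"
    using corner_support [OF uvw] by metis
  have abs: "\<bar>n \<bullet> x\<bar> \<le> b" if "x \<in> U" for x
    using n(5) [OF that] n(5) [OF anti [OF that]] by simp
  obtain y where "y \<in> U" "n \<bullet> y \<noteq> 0" using full_U [OF n(1)] by blast
  then have b: "b > 0" using abs by fastforce
  show thesis
    by (rule that [of "n /\<^sub>R b"])
       (use n b abs in \<open>auto simp: abs_mult divide_simps\<close>)
qed

lemma degree3_alpha: assumes "q = 3" "corner u v w" shows "3 * \<alpha> = 2 * \<kappa> - 1"
  using alpha_eq [OF assms(2)] degree3(1) [OF assms] by simp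

text \<open>A step along a Petrie polygon: \<open>v\<close>, \<open>w\<close> and the new vertex are in a common facet, but not in
  the facet of \<open>u\<close>, \<open>v\<close> and \<open>w\<close>. The new vertex is the third neighbour of \<open>w\<close>, besides \<open>v\<close> and the
  vertex that follows \<open>w\<close> in that facet.\<close>
lemma petrie_step:
  assumes q3: "q = 3" and uvw: "corner u v w"
  shows "corner v w ((\<kappa> - 1) *\<^sub>R (v + w) - u)"
proof -
  have eq: "(2 * \<kappa> - 1) *\<^sub>R w - (u + \<kappa> *\<^sub>R (w - v)) - v = (\<kappa> - 1) *\<^sub>R (v + w) - u"
    by (simp add: vec_eq_iff algebra_simps)
  have "corner v w ((3 * \<alpha>) *\<^sub>R w - (u + \<kappa> *\<^sub>R (w - v)) - v)"
    using degree3(2) [OF q3 corner_sym [OF corner_step [OF uvw]]] .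
  then show ?thesis
    unfolding degree3_alpha [OF assms] eq .
qed

lemma octahedron_corner:
  assumes "q = 4" "\<kappa> = 0" "corner u v w" shows "\<alpha> = 0" "corner (- u) v w"
proof -
  have g: "g = 0" using degree4 assms by blast
  show a: "\<alpha> = 0" using alpha_eq [OF assms(3)] g assms by simp
  obtain d where d: "d \<noteq> u" "corner w v d" using corner_other [OF corner_sym [OF assms(3)]] by blast
  then have "d = - u" using corner_chain [OF assms(3) d(2)] g a by simp
  then show "corner (- u) v w" using corner_sym d by blast
qed

lemma antipodal_octahedron:
  assumes "q = 4" "\<kappa> = 0" "x \<in> U" shows "- x \<in> U"
  using corner_starting_at [OF assms(3)] octahedron_corner(2) [OF assms(1,2)] corner_U(1) by metis

text \<open>The Petrie polygon of the cube is a hexagon, and antipodes are three steps apart.\<close>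
lemma antipodal_cube:
  assumes "q = 3" "\<kappa> = 1" "x \<in> U" shows "- x \<in> U"
proof -
  obtain v w where "corner x v w" using corner_starting_at assms by blast
  from corner_U(3) [OF petrie_step [OF assms(1) this]] show ?thesis using assms by simp
qed

text \<open>The Petrie polygon of the dodecahedron is a decagon, and antipodes are five steps apart.\<close>
lemma antipodal_dodecahedron:
  assumes "q = 3" "\<kappa>\<^sup>2 = \<kappa> + 1" "x \<in> U" shows "- x \<in> U"
proof -
  define h where "h = \<kappa> - 1"
  have h: "h * h = 1 - h" using assms(2) unfolding h_def by (simp add: power2_eq_square algebra_simps)
  note step = petrie_step [OF assms(1), folded h_def]
  obtain v w where "corner x v w" using corner_starting_at assms by blast
  define p3 where "p3 = h *\<^sub>R (v + w) - x"
  define p4 where "p4 = h *\<^sub>R (w + p3) - v"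
  have c3: "corner v w p3" using step \<open>corner x v w\<close> by (simp add: p3_def)
  have c4: "corner w p3 p4" using step [OF c3] by (simp add: p4_def)
  have "h *\<^sub>R (p3 + p4) - w \<in> U" using step [OF c4] corner_U(3) by blast
  also have "h *\<^sub>R (p3 + p4) - w
      = (h * (h * h + h - 1)) *\<^sub>R v + (h * h * h + h * h + h * h - 1) *\<^sub>R w - (h * h + h) *\<^sub>R x"
    by (simp add: vec_eq_iff p3_def p4_def algebra_simps)
  also have "\<dots> = - x"
  proof -
    have "h * h * h + h * h + h * h - 1 = 0" "h * h + h = 1" using h by algebra+
    then show ?thesis by simp
  qed
  finally show ?thesis .
qed

text \<open>Let \<open>x, b, u1, u0\<close> be consecutive neighbours of \<open>v\<close>. Since the facets are triangles, \<open>v\<close> and \<open>u1\<close>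
  are consecutive neighbours of \<open>u0\<close>, and the neighbour of \<open>u0\<close> that follows \<open>u1\<close> is \<open>- x\<close>.\<close>
lemma antipodal_icosahedron:
  assumes "q = 5" "\<kappa> = 0" "x \<in> U" shows "- x \<in> U"
proof -
  obtain v b where c: "corner x v b" using corner_starting_at assms by blast
  have gg: "g\<^sup>2 + g = 1" using degree5 assms(1) c by blast
  have ga: "(2 - g) * \<alpha> = g" using alpha_eq [OF c] assms by (simp add: algebra_simps)
  have tri: "corner v w u" if "corner u v w" for u v w
    using corner_step [OF that] assms by simp
  have next_corner: "corner w v (g *\<^sub>R w + g *\<^sub>R v - u)" if uvw: "corner u v w" for u v w
  proof -
    obtain d where d: "d \<noteq> u" "corner w v d" using corner_other [OF corner_sym [OF uvw]] by blast
    then show ?thesis using corner_chain [OF uvw d(2)] ga by simp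
  qed
  define u1 where "u1 = g *\<^sub>R b + g *\<^sub>R v - x"
  define u0 where "u0 = g *\<^sub>R u1 + g *\<^sub>R v - b"
  have "corner b v u1" using next_corner [OF c] by (simp add: u1_def)
  then have "corner u1 v u0" using next_corner by (simp add: u0_def)
  then have "corner v u0 u1" by (rule tri)
  then have "g *\<^sub>R u1 + g *\<^sub>R u0 - v \<in> U" using next_corner corner_U(3) by blast
  also have "g *\<^sub>R u1 + g *\<^sub>R u0 - v = - x"
  proof -
    have "g *\<^sub>R u1 + g *\<^sub>R u0 - v = (g * (g * g + g - 1)) *\<^sub>R b + (g * g * g + g * g + g * g - 1) *\<^sub>R v - (g * g + g) *\<^sub>R x"
      by (simp add: vec_eq_iff u0_def u1_def algebra_simps)
    moreover have "g * g * g + g * g + g * g - 1 = 0" "g * g + g = 1" using gg by algebra+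
    ultimately show ?thesis by simp
  qed
  finally show ?thesis .
qed

end

section \<open>Sums of squared distances\<close>

definition distances :: "'a::metric_space set \<Rightarrow> real set" where
  "distances U = {dist v w | v w. v \<in> U \<and> w \<in> U \<and> v \<noteq> w}"

lemma finite_distances: "finite U \<Longrightarrow> finite (distances U)"
proof -
  assume "finite U"
  then have "finite ((\<lambda>(x, y). dist x y) ` (U \<times> U))" by simp
  moreover have "distances U \<subseteq> (\<lambda>(x, y). dist x y) ` (U \<times> U)"
    by (auto simp: distances_def)
  ultimately show ?thesis by (rule finite_subset [rotated])
qed

lemma dist_power2_unit:
  fixes x y :: "'a::real_inner"
  assumes "norm x = 1" "norm y = 1"
  shows "(dist x y)\<^sup>2 = 2 - 2 * (x \<bullet> y)"
  using dot_norm_neg [of x y] assms by (simp add: dist_norm)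

lemma unit_eqI:
  fixes x y :: "'a::real_inner"
  assumes "norm x = 1" "norm y = 1"
  shows "x \<bullet> y = 1 \<Longrightarrow> x = y" "x \<bullet> y = - 1 \<Longrightarrow> x = - y"
proof -
  show "x \<bullet> y = 1 \<Longrightarrow> x = y"
    using dist_power2_unit [OF assms] by simp
  show "x \<bullet> y = - 1 \<Longrightarrow> x = - y"
    using dist_power2_unit [of x "- y"] assms by simp
qed

text \<open>If \<open>d\<close> is the distance of \<open>v\<close> and \<open>w\<close>, then \<open>sqrt (4 - d\<^sup>2)\<close> is that of \<open>v\<close> and \<open>- w\<close>. This
  is an involution of the set of distances other than \<open>2\<close>, and it turns the sum of squares \<open>S\<close> over this set of
  size \<open>k - 1\<close> into \<open>4 (k - 1) - S\<close>.\<close>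
lemma sum_distances_antipodal:
  fixes U :: "'a::real_inner set"
  assumes fin: "finite U" and ne: "U \<noteq> {}" and unit: "\<And>x. x \<in> U \<Longrightarrow> norm x = 1"
    and anti: "\<And>x. x \<in> U \<Longrightarrow> - x \<in> U"
  shows "(\<Sum>d\<in>distances U. d\<^sup>2) = 2 * real (card (distances U)) + 2"
proof -
  let ?D = "distances U"
  let ?\<sigma> = "\<lambda>d::real. sqrt (4 - d\<^sup>2)"
  have finD: "finite ?D" using fin by (rule finite_distances)
  obtain x where x: "x \<in> U" using ne by blast
  have "x \<noteq> - x" using unit [OF x] unit_eqI(1) [of x "- x"]
    by (metis add_eq_0_iff2 norm_zero scaleR_2 scaleR_eq_0_iff zero_neq_numeral zero_neq_one)
  moreover have "dist x (- x) = 2"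
    using unit [OF x] by (simp add: dist_norm) (metis norm_scaleR abs_numeral mult.right_neutral scaleR_2)
  ultimately have two: "2 \<in> ?D"
    using x anti unfolding distances_def by fastforce
  have inv: "?\<sigma> d \<in> ?D - {2} \<and> ?\<sigma> (?\<sigma> d) = d \<and> (?\<sigma> d)\<^sup>2 = 4 - d\<^sup>2" if d: "d \<in> ?D - {2}" for d
  proof -
    from d obtain v w where vw: "v \<in> U" "w \<in> U" "v \<noteq> w" "d = dist v w" and "d \<noteq> 2"
      by (auto simp: distances_def)
    have n: "norm v = 1" "norm w = 1" using vw unit by auto
    have "(dist v (- w))\<^sup>2 = 4 - d\<^sup>2"
      using dist_power2_unit [of v "- w"] dist_power2_unit [of v w] n vw by simp
    then have s: "?\<sigma> d = dist v (- w)" and le: "d\<^sup>2 \<le> 4"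
      by (metis real_sqrt_unique zero_le_dist) (metis \<open>(dist v (- w))\<^sup>2 = 4 - d\<^sup>2\<close> diff_ge_0_iff_ge zero_le_power2)
    have "v \<noteq> - w"
    proof
      assume "v = - w"
      then have "d\<^sup>2 = 2\<^sup>2" using \<open>(dist v (- w))\<^sup>2 = 4 - d\<^sup>2\<close> by simp
      then have "d = 2" by (metis power2_eq_imp_eq vw(4) zero_le_dist zero_le_numeral)
      with \<open>d \<noteq> 2\<close> show False ..
    qed
    then have "?\<sigma> d \<in> ?D" using vw anti s unfolding distances_def by blast
    moreover have "?\<sigma> d \<noteq> 2"
    proof
      assume "?\<sigma> d = 2"
      then have "4 - d\<^sup>2 = 2\<^sup>2" using le by (metis diff_ge_0_iff_ge real_sqrt_pow2)
      then show False using vw by simp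
    qed
    moreover have "?\<sigma> (?\<sigma> d) = d" using le vw by simp
    ultimately show ?thesis using le by simp
  qed
  have "(\<Sum>d\<in>?D - {2}. d\<^sup>2) = (\<Sum>d\<in>?D - {2}. 4 - d\<^sup>2)"
  proof (rule sum.reindex_bij_witness [of _ ?\<sigma> ?\<sigma>])
    fix d assume "d \<in> ?D - {2}"
    note i = inv [OF this]
    show "?\<sigma> d \<in> ?D - {2}" "?\<sigma> d \<in> ?D - {2}" by (fact i [THEN conjunct1])+
    show "?\<sigma> (?\<sigma> d) = d" "?\<sigma> (?\<sigma> d) = d" by (fact i [THEN conjunct2, THEN conjunct1])+
    show "4 - (?\<sigma> d)\<^sup>2 = d\<^sup>2" using i [THEN conjunct2, THEN conjunct2] by linarith
  qed
  then have "(\<Sum>d\<in>?D - {2}. d\<^sup>2) = 2 * real (card (?D - {2}))"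
    using finD by (simp add: sum_subtractf)
  moreover have "(\<Sum>d\<in>?D. d\<^sup>2) = 2\<^sup>2 + (\<Sum>d\<in>?D - {2}. d\<^sup>2)"
    using finD two by (rule sum.remove)
  moreover have "card ?D = Suc (card (?D - {2}))"
    using finD two by (rule card.remove)
  ultimately show ?thesis by simp
qed

lemma distances_translation:
  fixes c :: "'a::real_normed_vector"
  shows "distances ((+) c ` U) = distances U"
proof -
  have "distances ((+) c ` U) = {dist (c + v) (c + w) | v w. v \<in> U \<and> w \<in> U \<and> c + v \<noteq> c + w}"
    unfolding distances_def by blast
  then show ?thesis by (simp add: distances_def dist_norm)
qed

section \<open>The vertices of the tetrahedron, the octahedron and the cube\<close>

text \<open>The vertices of the octahedron are an orthonormal basis and its antipodes (\<open>\<rho> = 0\<close>); those of the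
  cube are the vertices of a regular tetrahedron and their antipodes (\<open>\<rho> = - 1/3\<close>).\<close>
lemma double_simplex:
  fixes A :: "'a::real_inner set"
  assumes fin: "finite A" and A2: "a0 \<in> A" "b0 \<in> A" "a0 \<noteq> b0"
    and unit: "\<And>x. x \<in> A \<Longrightarrow> norm x = 1"
    and ip: "\<And>x y. x \<in> A \<Longrightarrow> y \<in> A \<Longrightarrow> x \<noteq> y \<Longrightarrow> x \<bullet> y = \<rho>"
    and \<rho>: "\<bar>\<rho>\<bar> < 1"
  defines "U \<equiv> A \<union> uminus ` A"
  shows "card U = 2 * card A" "distances U = {sqrt (2 - 2 * \<rho>), sqrt (2 + 2 * \<rho>), 2}"
proof -
  have neg: "- x \<noteq> y" if "x \<in> A" "y \<in> A" for x y
  proof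
    assume "- x = y"
    then have "x \<bullet> y = - 1" using unit [OF that(1)] by (auto simp: dot_square_norm)
    moreover have "x \<bullet> x = 1" using unit [OF that(1)] by (simp add: dot_square_norm)
    ultimately show False using ip [OF that] \<rho> by (cases "x = y") auto
  qed
  have "A \<inter> uminus ` A = {}" using neg by auto
  then have "card U = card A + card (uminus ` A)"
    unfolding U_def using fin by (intro card_Un_disjoint) auto
  then show "card U = 2 * card A" by (simp add: card_image)
  have d: "dist x y = sqrt (2 - 2 * (x \<bullet> y))" if "norm x = 1" "norm y = 1" for x y :: 'a
    using dist_power2_unit [OF that] by (metis real_sqrt_unique zero_le_dist)
  have U1: "norm x = 1" if "x \<in> U" for x using that unit by (auto simp: U_def)
  have vals: "x \<bullet> y \<in> {\<rho>, - \<rho>, - 1}" if xy: "x \<in> U" "y \<in> U" "x \<noteq> y" for x y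
  proof -
    have sq: "a \<bullet> a = 1" if "a \<in> A" for a using unit that by (simp add: dot_square_norm)
    consider "x \<in> A" "y \<in> A" | a where "a \<in> A" "x = - a" "y \<in> A" | b where "x \<in> A" "b \<in> A" "y = - b"
      | a b where "a \<in> A" "x = - a" "b \<in> A" "y = - b"
      using xy unfolding U_def by blast
    then show ?thesis
    proof cases
      case 1 then show ?thesis using ip xy by simp
    next
      case 2 then show ?thesis using ip [of a y] sq by (cases "a = y") auto
    next
      case 3 then show ?thesis using ip [of x b] sq by (cases "x = b") auto
    next
      case 4 then show ?thesis using ip [of a b] xy by auto
    qed
  qed
  show "distances U = {sqrt (2 - 2 * \<rho>), sqrt (2 + 2 * \<rho>), 2}" (is "_ = ?R")
  proof
    have four: "sqrt 4 = (2::real)" by simp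
    show "distances U \<subseteq> ?R"
    proof
      fix z assume "z \<in> distances U"
      then obtain x y where "x \<in> U" "y \<in> U" "x \<noteq> y" "z = dist x y"
        by (auto simp: distances_def)
      with vals d U1 have "x \<bullet> y \<in> {\<rho>, - \<rho>, - 1}" "z = sqrt (2 - 2 * (x \<bullet> y))" by auto
      then show "z \<in> ?R" using four by auto
    qed
    have in_U: "a0 \<in> U" "b0 \<in> U" "- a0 \<in> U" "- b0 \<in> U" using A2 by (auto simp: U_def)
    have "dist a0 b0 \<in> distances U" "dist a0 (- b0) \<in> distances U" "dist a0 (- a0) \<in> distances U"
      using in_U A2 neg [of a0 a0] neg [of b0 a0] unfolding distances_def by fastforce+
    moreover have "a0 \<bullet> a0 = 1" "a0 \<bullet> b0 = \<rho>" using A2 ip unit by (simp_all add: dot_square_norm)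
    ultimately show "?R \<subseteq> distances U"
      using d U1 in_U four by simp
  qed
qed

text \<open>The vertices of a regular tetrahedron form a tight frame: their dyadic products add up to \<open>4/3\<close>
  times the identity. The proof passes to the sums of pairs of them, which are orthogonal.\<close>
lemma tetrahedral_expansion:
  fixes a b c d y :: "real ^ 3"
  assumes unit: "a \<bullet> a = 1" "b \<bullet> b = 1" "c \<bullet> c = 1"
    and ip: "a \<bullet> b = - 1/3" "a \<bullet> c = - 1/3" "b \<bullet> c = - 1/3"
    and d: "d = - (a + b + c)"
  shows "y = (3/4) *\<^sub>R ((y \<bullet> a) *\<^sub>R a + (y \<bullet> b) *\<^sub>R b + (y \<bullet> c) *\<^sub>R c + (y \<bullet> d) *\<^sub>R d)"
proof -
  define z where "z = y - (3/4) *\<^sub>R ((y \<bullet> a) *\<^sub>R a + (y \<bullet> b) *\<^sub>R b + (y \<bullet> c) *\<^sub>R c + (y \<bullet> d) *\<^sub>R d)"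
  have ip': "b \<bullet> a = - 1/3" "c \<bullet> a = - 1/3" "c \<bullet> b = - 1/3"
    using ip by (simp_all add: inner_commute)
  have di: "d \<bullet> a = - 1/3" "d \<bullet> b = - 1/3" "d \<bullet> c = - 1/3" "y \<bullet> d = - (y \<bullet> a + y \<bullet> b + y \<bullet> c)"
    by (simp_all add: d inner_add_left inner_add_right inner_diff_left inner_diff_right unit ip ip')
  have z: "z \<bullet> a = 0" "z \<bullet> b = 0" "z \<bullet> c = 0"
    by (simp_all add: z_def inner_diff_left inner_add_left unit ip ip' di field_simps)
  have "z = 0"
  proof (rule orthogonal_to_three)
    have sq: "(a + b) \<bullet> (a + b) = 4/3" "(a + c) \<bullet> (a + c) = 4/3" "(b + c) \<bullet> (b + c) = 4/3"
      by (simp_all add: inner_simps unit ip ip')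
    then show "a + b \<noteq> 0" "a + c \<noteq> 0" "b + c \<noteq> 0" by auto
  qed (simp_all add: inner_simps unit ip ip' z)
  then show ?thesis by (simp add: z_def)
qed

text \<open>A vector with nonnegative entries whose 2-norm is not less than its 1-norm has at most one
  nonzero entry.\<close>
lemma sum_nonneg_square_extreme:
  fixes a b c d :: real
  assumes "0 \<le> a" "0 \<le> b" "0 \<le> c" "0 \<le> d"
    and "a + b + c + d \<le> k" "a\<^sup>2 + b\<^sup>2 + c\<^sup>2 + d\<^sup>2 = k\<^sup>2"
  shows "a = k \<or> b = k \<or> c = k \<or> d = k"
proof -
  have p: "0 \<le> a * b" "0 \<le> a * c" "0 \<le> a * d" "0 \<le> b * c" "0 \<le> b * d" "0 \<le> c * d"
    using assms by simp_all
  have "(a + b + c + d)\<^sup>2 \<le> k\<^sup>2"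
    using assms by (intro power_mono) auto
  moreover have "(a + b + c + d)\<^sup>2 = k\<^sup>2 + 2 * (a * b + a * c + a * d + b * c + b * d + c * d)"
    using assms(6) by algebra
  ultimately have "k\<^sup>2 + 2 * (a * b + a * c + a * d + b * c + b * d + c * d) \<le> k\<^sup>2" by (simp only:)
  then have "a * b + a * c + a * d + b * c + b * d + c * d \<le> 0" by simp
  with p have "a * b = 0" "a * c = 0" "a * d = 0" "b * c = 0" "b * d = 0" "c * d = 0"
    by linarith+
  then have "a = 0 \<and> b = 0 \<and> c = 0 \<or> a = 0 \<and> b = 0 \<and> d = 0 \<or> a = 0 \<and> c = 0 \<and> d = 0 \<or> b = 0 \<and> c = 0 \<and> d = 0"
    by auto
  moreover have "0 \<le> k" using assms by linarith
  ultimately show ?thesis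
    using assms by (auto simp: power2_eq_iff_nonneg)
qed

lemma extreme_pair_sums:
  fixes a b c :: real
  assumes "(a + b)\<^sup>2 = (2/3)\<^sup>2" "(b + c)\<^sup>2 = (2/3)\<^sup>2" "(c + a)\<^sup>2 = (2/3)\<^sup>2"
  shows "\<bar>a\<bar> = 1 \<or> \<bar>b\<bar> = 1 \<or> \<bar>c\<bar> = 1 \<or> \<bar>a + b + c\<bar> = 1"
proof -
  define p q r where "p = a + b" and "q = b + c" and "r = c + a"
  have abc: "a = (p + r - q) / 2" "b = (p + q - r) / 2" "c = (q + r - p) / 2" "a + b + c = (p + q + r) / 2"
    by (simp_all add: p_def q_def r_def)
  have "p = 2/3 \<or> p = - (2/3)" "q = 2/3 \<or> q = - (2/3)" "r = 2/3 \<or> r = - (2/3)"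
    using assms unfolding power2_eq_iff p_def q_def r_def by blast+
  then have "\<bar>(p + r - q) / 2\<bar> = 1 \<or> \<bar>(p + q - r) / 2\<bar> = 1 \<or> \<bar>(q + r - p) / 2\<bar> = 1 \<or> \<bar>(p + q + r) / 2\<bar> = 1"
    by (elim disjE) simp_all
  then show ?thesis unfolding abc [symmetric] .
qed

context regular_facets
begin

text \<open>A corner \<open>u, v, w\<close> is an orthonormal basis, and its vectors may be replaced by their negatives.
  The resulting facets bound the sum of the absolute values of the coordinates by \<open>1\<close>, and a
  unit vector that satisfies this is a basis vector up to sign.\<close>
lemma octahedron_vertices:
  assumes "q = 4" "\<kappa> = 0"
  shows "card U = 6" "card (distances U) = 2"
proof -
  obtain u v w where c: "corner u v w" using neU corner_exists by blast
  have anti: "- x \<in> U" if "x \<in> U" for x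
    using antipodal_octahedron assms that by blast
  have tri: "corner v w u" if "corner u v w" for u v w
    using corner_step [OF that] assms by simp
  have flip: "corner (- u) v w" if "corner u v w" for u v w
    using octahedron_corner(2) assms that by blast
  have a0: "\<alpha> = 0" using octahedron_corner(1) assms c by blast
  have ip: "u \<bullet> v = 0" "u \<bullet> w = 0" "v \<bullet> w = 0" using corner_inner [OF c] a0 assms by auto
  have ip': "v \<bullet> u = 0" "w \<bullet> u = 0" "w \<bullet> v = 0" using ip by (simp_all add: inner_commute)
  have un: "u \<bullet> u = 1" "v \<bullet> v = 1" "w \<bullet> w = 1" using corner_U [OF c] U_inner by auto
  have exp: "y = (y \<bullet> u) *\<^sub>R u + (y \<bullet> v) *\<^sub>R v + (y \<bullet> w) *\<^sub>R w" for y
  proof -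
    have "y - ((y \<bullet> u) *\<^sub>R u + (y \<bullet> v) *\<^sub>R v + (y \<bullet> w) *\<^sub>R w) = 0"
      by (rule orthogonal_to_three [of u v w]) (use un in \<open>auto simp: inner_simps ip ip'\<close>)
    then show ?thesis by simp
  qed
  have face: "\<bar>x \<bullet> u * i + x \<bullet> v * j + x \<bullet> w * k\<bar> \<le> 1"
    if x: "x \<in> U" and cc: "corner (i *\<^sub>R u) (j *\<^sub>R v) (k *\<^sub>R w)" and ijk: "i * i = 1" "j * j = 1" "k * k = 1"
    for x i j k
  proof -
    obtain n where n: "n \<bullet> (i *\<^sub>R u) = 1" "n \<bullet> (j *\<^sub>R v) = 1" "n \<bullet> (k *\<^sub>R w) = 1" "\<bar>n \<bullet> x\<bar> \<le> 1"
      using corner_support_antipodal [OF anti cc] x by metis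
    have "n \<bullet> u = i" "n \<bullet> v = j" "n \<bullet> w = k"
      using n(1-3) ijk by (simp_all, (metis mult.left_commute mult.right_neutral)+)
    moreover have "n \<bullet> x = (n \<bullet> u) * (x \<bullet> u) + (n \<bullet> v) * (x \<bullet> v) + (n \<bullet> w) * (x \<bullet> w)"
      by (subst exp [of x]) (simp add: inner_simps mult.commute)
    ultimately show ?thesis using n(4) by (simp add: mult.commute)
  qed
  have cs: "corner (- u) v w" "corner u (- v) w" "corner u v (- w)"
    using flip tri c by blast+
  have xin: "x \<in> {u, v, w} \<union> uminus ` {u, v, w}" if x: "x \<in> U" for x
  proof -
    have "\<bar>x \<bullet> u\<bar> + \<bar>x \<bullet> v\<bar> + \<bar>x \<bullet> w\<bar> + 0 \<le> 1"
      using face [OF x, of 1 1 1] face [OF x, of "- 1" 1 1] face [OF x, of 1 "- 1" 1]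
        face [OF x, of 1 1 "- 1"] c cs by (simp add: abs_if split: if_splits)
    moreover have "\<bar>x \<bullet> u\<bar>\<^sup>2 + \<bar>x \<bullet> v\<bar>\<^sup>2 + \<bar>x \<bullet> w\<bar>\<^sup>2 + 0\<^sup>2 = 1\<^sup>2"
    proof -
      have "x \<bullet> x = (x \<bullet> u) * (x \<bullet> u) + (x \<bullet> v) * (x \<bullet> v) + (x \<bullet> w) * (x \<bullet> w)"
        by (subst (2) exp [of x]) (simp add: inner_simps)
      then show ?thesis using U_inner [OF x] by (simp add: power2_eq_square)
    qed
    ultimately have "\<bar>x \<bullet> u\<bar> = 1 \<or> \<bar>x \<bullet> v\<bar> = 1 \<or> \<bar>x \<bullet> w\<bar> = 1"
      using sum_nonneg_square_extreme [of "\<bar>x \<bullet> u\<bar>" "\<bar>x \<bullet> v\<bar>" "\<bar>x \<bullet> w\<bar>" 0 1] by auto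
    then show ?thesis
      using unit_eqI [of x u] unit_eqI [of x v] unit_eqI [of x w] U_norm x corner_U [OF c]
      by (auto simp: abs_if split: if_splits)
  qed
  have Ueq: "U = {u, v, w} \<union> uminus ` {u, v, w}"
    using xin corner_U [OF c] anti by auto
  have ne: "u \<noteq> v" "u \<noteq> w" "v \<noteq> w" using corner_neq [OF c] by auto
  have nrm: "norm u = 1" "norm v = 1" "norm w = 1" using corner_U [OF c] U_norm by auto
  note ds = double_simplex [of "{u, v, w}" u v 0]
  show "card U = 6"
    unfolding Ueq by (subst ds(1)) (use ne nrm ip ip' in auto)
  have "distances U = {sqrt (2 - 2 * 0), sqrt (2 + 2 * 0), 2}"
    unfolding Ueq by (rule ds(2)) (use ne nrm ip ip' in auto)
  moreover have "sqrt 2 \<noteq> 2" using real_sqrt_eq_iff [of 2 4] by simp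
  ultimately show "card (distances U) = 2" by simp
qed

text \<open>Let \<open>u, w, t\<close> be the neighbours of \<open>v\<close>. Then \<open>u, w, t, - v\<close> is a regular tetrahedron. The three
  facets at \<open>v\<close> have the pairwise orthogonal normals \<open>u + w, w + t, t + u\<close>. These bound three
  coordinates of a vertex, and a unit vector attains all the bounds, so that only
  eight sign patterns remain.\<close>
lemma cube_vertices:
  assumes "q = 3" "\<kappa> = 1"
  shows "card U = 8" "card (distances U) = 3"
proof -
  obtain u v w where c: "corner u v w" using neU corner_exists by blast
  have anti: "- x \<in> U" if "x \<in> U" for x
    using antipodal_cube assms that by blast
  have a: "\<alpha> = 1/3" using degree3_alpha [OF assms(1) c] assms by simp
  define t where "t = v - u - w"
  have cwt: "corner w v t" using degree3(2) [OF assms(1) c] a by (simp add: t_def)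
  have ctu: "corner t v u" using degree3(2) [OF assms(1) cwt] a by (simp add: t_def)
  have un: "u \<bullet> u = 1" "v \<bullet> v = 1" "w \<bullet> w = 1" "t \<bullet> t = 1" using corner_U [OF c] corner_U [OF cwt] U_inner by auto
  have ip: "u \<bullet> w = - 1/3" "u \<bullet> t = - 1/3" "w \<bullet> t = - 1/3"
    using corner_inner [OF c] corner_inner [OF cwt] corner_inner [OF ctu] a assms by auto
  have ipv: "v \<bullet> u = 1/3" "v \<bullet> w = 1/3" "v \<bullet> t = 1/3"
    using corner_inner [OF c] corner_inner [OF cwt] a by auto
  have v: "- v = - (u + w + t)" by (simp add: t_def)
  note exp = tetrahedral_expansion [OF un(1,3,4) ip v]
  have face: "\<bar>x \<bullet> a + x \<bullet> b\<bar> \<le> 2/3" if x: "x \<in> U" and cc: "corner a v b"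
    and abc: "(a, b, d) \<in> {(u, w, t), (w, t, u), (t, u, w)}" for x a b d
  proof -
    obtain n where n: "n \<bullet> a = 1" "n \<bullet> v = 1" "n \<bullet> b = 1" "\<bar>n \<bullet> x\<bar> \<le> 1"
      using corner_support_antipodal [OF anti cc] x by metis
    have d: "d = v - a - b" using abc by (auto simp: t_def)
    then have nd: "n \<bullet> d = - 1" using n by (simp add: inner_simps)
    have "n = (3/4) *\<^sub>R ((n \<bullet> a) *\<^sub>R a + (n \<bullet> b) *\<^sub>R b + (n \<bullet> d) *\<^sub>R d + (n \<bullet> (- v)) *\<^sub>R (- v))"
      by (subst exp [of n]) (use abc in \<open>auto simp: add_ac\<close>)
    also have "\<dots> = (3/4) *\<^sub>R (a + b - d + v)" using n nd by simp
    also have "\<dots> = (3/2) *\<^sub>R (a + b)" by (simp add: d algebra_simps flip: scaleR_2)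
    finally have "2 * (n \<bullet> x) = 3 * (x \<bullet> a + x \<bullet> b)" by (simp add: inner_simps inner_commute)
    moreover have "\<bar>q\<bar> \<le> 2/3" if "2 * p = 3 * q" "\<bar>p\<bar> \<le> 1" for p q :: real
      using that by linarith
    ultimately show ?thesis using n(4) by blast
  qed
  have xin: "x \<in> {u, w, t, - v} \<union> uminus ` {u, w, t, - v}" if x: "x \<in> U" for x
  proof -
    have f: "\<bar>x \<bullet> u + x \<bullet> w\<bar> \<le> 2/3" "\<bar>x \<bullet> w + x \<bullet> t\<bar> \<le> 2/3" "\<bar>x \<bullet> t + x \<bullet> u\<bar> \<le> 2/3"
      using face [OF x c] face [OF x cwt] face [OF x ctu] by auto
    have vs: "x \<bullet> v = x \<bullet> u + x \<bullet> w + x \<bullet> t" by (simp add: t_def inner_simps)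
    have "x \<bullet> x = (3/4) * ((x \<bullet> u) * (x \<bullet> u) + (x \<bullet> w) * (x \<bullet> w) + (x \<bullet> t) * (x \<bullet> t) + (x \<bullet> v) * (x \<bullet> v))"
      by (subst (2) exp [of x]) (simp add: inner_simps)
    then have sq: "(x \<bullet> u + x \<bullet> w)\<^sup>2 + (x \<bullet> w + x \<bullet> t)\<^sup>2 + (x \<bullet> t + x \<bullet> u)\<^sup>2 = 3 * (2/3)\<^sup>2"
      using U_inner [OF x] unfolding vs by (simp add: power2_eq_square field_simps)
    have "(x \<bullet> u + x \<bullet> w)\<^sup>2 \<le> (2/3)\<^sup>2" "(x \<bullet> w + x \<bullet> t)\<^sup>2 \<le> (2/3)\<^sup>2" "(x \<bullet> t + x \<bullet> u)\<^sup>2 \<le> (2/3)\<^sup>2"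
      using f by (simp_all add: abs_le_square_iff [symmetric])
    with sq have "(x \<bullet> u + x \<bullet> w)\<^sup>2 = (2/3)\<^sup>2" "(x \<bullet> w + x \<bullet> t)\<^sup>2 = (2/3)\<^sup>2" "(x \<bullet> t + x \<bullet> u)\<^sup>2 = (2/3)\<^sup>2"
      by linarith+
    then have "\<bar>x \<bullet> u\<bar> = 1 \<or> \<bar>x \<bullet> w\<bar> = 1 \<or> \<bar>x \<bullet> t\<bar> = 1 \<or> \<bar>x \<bullet> v\<bar> = 1"
      unfolding vs by (rule extreme_pair_sums)
    then show ?thesis
      using unit_eqI [of x u] unit_eqI [of x v] unit_eqI [of x w] unit_eqI [of x t] U_norm x
        corner_U [OF c] corner_U [OF cwt]
      by (auto simp: abs_if split: if_splits)
  qed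
  have Ueq: "U = {u, w, t, - v} \<union> uminus ` {u, w, t, - v}"
  proof
    have "{u, w, t, - v} \<subseteq> U"
      using corner_U [OF c] corner_U [OF cwt] anti by simp
    moreover from this have "uminus ` {u, w, t, - v} \<subseteq> U" using anti by blast
    ultimately show "{u, w, t, - v} \<union> uminus ` {u, w, t, - v} \<subseteq> U" by (rule Un_least)
  qed (use xin in blast)
  have ne: "u \<noteq> w" "u \<noteq> t" "w \<noteq> t" "u \<noteq> - v" "w \<noteq> - v" "t \<noteq> - v" using ip ipv un by auto
  have nrm: "norm u = 1" "norm v = 1" "norm w = 1" "norm t = 1" using corner_U [OF c] corner_U [OF cwt] U_norm by auto
  have all: "x \<bullet> y = - 1/3" if "x \<in> {u, w, t, - v}" "y \<in> {u, w, t, - v}" "x \<noteq> y" for x y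
    using that ip ipv by (auto simp: inner_commute)
  note ds = double_simplex [of "{u, w, t, - v}" u w "- 1/3"]
  show "card U = 8"
    unfolding Ueq by (subst ds(1)) (use ne nrm all in auto)
  have "distances U = {sqrt (2 - 2 * (- 1/3)), sqrt (2 + 2 * (- 1/3)), 2}"
    unfolding Ueq by (rule ds(2)) (use ne nrm all in auto)
  moreover have "sqrt (8/3) \<noteq> sqrt (4/3)" "sqrt (8/3) \<noteq> 2" "sqrt (4/3) \<noteq> 2"
    using real_sqrt_eq_iff [of "8/3" 4] real_sqrt_eq_iff [of "4/3" 4] by simp_all
  ultimately show "card (distances U) = 3" by simp
qed

text \<open>The four points \<open>u, v, w, t\<close> reached from one corner span four facets. The facet opposite to \<open>d\<close>
  shows \<open>- 1/3 \<le> x \<bullet> d\<close> for every vertex \<open>x\<close>. After adding \<open>1/3\<close> the four inner products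
  are nonnegative with sum \<open>4/3\<close> and sum of squares \<open>(4/3)\<^sup>2\<close>, so one of them is \<open>4/3\<close>, which means that
  \<open>x\<close> is one of the four points.\<close>
lemma tetrahedron_inner:
  assumes "q = 3" "\<kappa> = 0" "x \<in> U" "y \<in> U" "x \<noteq> y"
  shows "x \<bullet> y = - 1/3"
proof -
  obtain u v w where c: "corner u v w" using neU corner_exists by blast
  have a: "\<alpha> = - 1/3" using degree3_alpha [OF assms(1) c] assms by simp
  define t where "t = - (u + v + w)"
  have deg3: "corner w v (- v - u - w)" if "corner u v w" for u v w
    using degree3(2) [OF assms(1) that] a by (simp add: algebra_simps)
  have tri: "corner v w u" if "corner u v w" for u v w
    using corner_step [OF that] assms by simp
  have t: "- v - u - w = t" "- v - w - t = u" "- w - v - u = t"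
    by (simp_all add: t_def vec_eq_iff)
  have cwt: "corner w v t" using deg3 [OF c] by (simp only: t)
  have ctu: "corner t v u" using deg3 [OF cwt] by (simp only: t)
  have cut: "corner u w t" using deg3 [OF tri [OF c]] by (simp only: t)
  have ip: "u \<bullet> v = - 1/3" "u \<bullet> w = - 1/3" "v \<bullet> w = - 1/3" "u \<bullet> t = - 1/3" "v \<bullet> t = - 1/3" "w \<bullet> t = - 1/3"
    using corner_inner [OF c] corner_inner [OF cwt] corner_inner [OF ctu] a assms by auto
  have un: "u \<bullet> u = 1" "v \<bullet> v = 1" "w \<bullet> w = 1" "t \<bullet> t = 1" using corner_U [OF c] corner_U [OF cwt] U_inner by auto
  have face: "- 1/3 \<le> x \<bullet> d"
    if x: "x \<in> U" and cc: "corner a b e" and d: "d \<in> U" "d = - (a + b + e)" for x a b e d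
  proof -
    have i: "a \<bullet> b = - 1/3" "a \<bullet> e = - 1/3" "b \<bullet> e = - 1/3"
      using corner_inner [OF cc] \<open>\<alpha> = - 1/3\<close> assms by auto
    have aa: "a \<bullet> a = 1" "b \<bullet> b = 1" "e \<bullet> e = 1" using corner_U [OF cc] U_inner by auto
    obtain n B where n: "n \<noteq> 0" "n \<bullet> a = B" "n \<bullet> b = B" "n \<bullet> e = B" "\<And>x. x \<in> U \<Longrightarrow> n \<bullet> x \<le> B"
      using corner_support [OF cc] by metis
    have nd: "n \<bullet> d = - 3 * B" using n(2-4) by (simp add: d(2) inner_simps)
    have "n = (3/4) *\<^sub>R ((n \<bullet> a) *\<^sub>R a + (n \<bullet> b) *\<^sub>R b + (n \<bullet> e) *\<^sub>R e + (n \<bullet> d) *\<^sub>R d)"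
      by (rule tetrahedral_expansion [OF aa i d(2)])
    also have "\<dots> = (3/4 * B) *\<^sub>R ((a + b + e) - 3 *\<^sub>R d)"
      using n nd by (simp add: algebra_simps)
    also have "a + b + e = - d" by (simp add: d(2))
    also have "(3/4 * B) *\<^sub>R (- d - 3 *\<^sub>R d) = (- 3 * B) *\<^sub>R d" by (simp add: vec_eq_iff)
    finally have nn: "n = (- 3 * B) *\<^sub>R d" .
    have "B \<ge> 0" using n(5) [OF d(1)] nd by simp
    moreover have "B \<noteq> 0" using n(1) nn by auto
    ultimately have "0 < B" by simp
    have "B * (- 3 * (x \<bullet> d)) \<le> B * 1" using n(5) [OF x] nn by (simp add: inner_commute)
    then have "- 3 * (x \<bullet> d) \<le> 1" using \<open>0 < B\<close> by (rule mult_left_le_imp_le)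
    then show ?thesis by simp
  qed
  have xin: "x \<in> {u, v, w, t}" if x: "x \<in> U" for x
  proof -
    have tU: "u \<in> U" "v \<in> U" "w \<in> U" "t \<in> U" using corner_U [OF c] corner_U [OF cwt] by auto
    have f: "- 1/3 \<le> x \<bullet> t" "- 1/3 \<le> x \<bullet> u" "- 1/3 \<le> x \<bullet> w" "- 1/3 \<le> x \<bullet> v"
      using face [OF x c tU(4)] face [OF x cwt tU(1)] face [OF x ctu tU(3)] face [OF x cut tU(2)]
      by (auto simp: t_def algebra_simps)
    have s: "x \<bullet> u + x \<bullet> v + x \<bullet> w + x \<bullet> t = 0" by (simp add: t_def inner_simps)
    have "x \<bullet> x = (3/4) * ((x \<bullet> u) * (x \<bullet> u) + (x \<bullet> v) * (x \<bullet> v) + (x \<bullet> w) * (x \<bullet> w) + (x \<bullet> t) * (x \<bullet> t))"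
      by (subst (2) tetrahedral_expansion [OF un(1-3) ip(1-3) t_def, of x]) (simp add: inner_simps)
    then have "(x \<bullet> u)\<^sup>2 + (x \<bullet> v)\<^sup>2 + (x \<bullet> w)\<^sup>2 + (x \<bullet> t)\<^sup>2 = 4/3"
      using U_inner [OF x] by (simp add: power2_eq_square)
    with s have "(x \<bullet> u + 1/3)\<^sup>2 + (x \<bullet> v + 1/3)\<^sup>2 + (x \<bullet> w + 1/3)\<^sup>2 + (x \<bullet> t + 1/3)\<^sup>2 = (4/3)\<^sup>2"
      by (simp add: power2_sum) (simp add: power2_eq_square)
    then have "x \<bullet> u + 1/3 = 4/3 \<or> x \<bullet> v + 1/3 = 4/3 \<or> x \<bullet> w + 1/3 = 4/3 \<or> x \<bullet> t + 1/3 = 4/3"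
      using f s by (intro sum_nonneg_square_extreme) auto
    then have "x \<bullet> u = 1 \<or> x \<bullet> v = 1 \<or> x \<bullet> w = 1 \<or> x \<bullet> t = 1" by auto
    then show ?thesis
      using unit_eqI(1) [of x] U_norm x tU by blast
  qed
  show ?thesis
    using xin [OF assms(3)] xin [OF assms(4)] assms(5) ip by (auto simp: inner_commute)
qed

end

section \<open>Regular polyhedra as systems of regular facets\<close>

text \<open>A facet is the convex hull of the vertices in it, so nothing is lost by replacing facets by their
  vertex sets. In particular the number of facets at a vertex stays the same.\<close>
lemma regular_polyhedron_facets:
  assumes reg: "regular_polyhedron p q P" and ins: "inscribed_in_sphere P c 1" and q: "0 < q"
  obtains s where "regular_facets (vertices P) ((\<lambda>F. F \<inter> vertices P) ` {F. F facet_of P}) c s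
    (1 + 2 * cos (2 * pi / p)) q"
proof -
  obtain r where polyt: "polytope P" and dim: "aff_dim P = 3"
    and faces: "\<And>F. F facet_of P \<Longrightarrow> regular_polygon p r F"
    and deg: "\<And>v. v \<in> vertices P \<Longrightarrow> card {F. F facet_of P \<and> v \<in> F} = q"
    using reg unfolding regular_polyhedron_def by blast
  let ?V = "vertices P"
  let ?FF = "(\<lambda>F. F \<inter> vertices P) ` {F. F facet_of P}"
  define s where "s = polygon_frame.side p r"
  have poly: "polyhedron P" using polyt by (rule polytope_imp_polyhedron)
  have conv: "convex P" using polyt by (rule polytope_imp_convex)
  have hullV: "P = convex hull ?V"
    unfolding vertices_def using polyt conv
    by (intro Krein_Milman_Minkowski) (simp_all add: polytope_imp_compact)
  have "P \<noteq> {}" using dim by auto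
  then have neV: "?V \<noteq> {}" using hullV by auto
  have facet_frame: "\<exists>m e f. polygon_frame p r e f \<and> F \<inter> ?V = range (polygon_frame.vtx p r m e f)
      \<and> F = convex hull (range (polygon_frame.vtx p r m e f))" if "F facet_of P" for F
    using facet_vertices [OF faces [OF that] that] by metis
  have hullF: "F = convex hull (F \<inter> ?V)" if "F facet_of P" for F
    using facet_frame [OF that] by auto
  have "regular_facets ?V ?FF c s (1 + 2 * cos (2 * pi / p)) q"
  proof
    show "finite ?V" unfolding vertices_def using poly by (rule finite_polyhedron_extreme_points)
    show "?V \<noteq> {}" by (fact neV)
    show "?V \<subseteq> sphere c 1" using ins by (simp add: inscribed_in_sphere_def)
    show "\<exists>x\<in>?V. n \<bullet> x \<noteq> b" if "n \<noteq> 0" for n b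
    proof (rule ccontr)
      assume "\<not> ?thesis"
      then have "?V \<subseteq> {x. n \<bullet> x = b}" by auto
      then have "P \<subseteq> {x. n \<bullet> x = b}"
        by (subst hullV) (intro hull_minimal convex_hyperplane)
      then have "aff_dim P \<le> aff_dim {x. n \<bullet> x = b}" by (rule aff_dim_subset)
      then show False using that dim by simp
    qed
    show "finite ?FF" using finite_polyhedron_facets [OF poly] by simp
    show "W \<subseteq> ?V" if "W \<in> ?FF" for W using that by auto
    show "card {W \<in> ?FF. v \<in> W} = q" if v: "v \<in> ?V" for v
    proof -
      have "{W \<in> ?FF. v \<in> W} = (\<lambda>F. F \<inter> ?V) ` {F. F facet_of P \<and> v \<in> F}" using v by auto
      moreover have "inj_on (\<lambda>F. F \<inter> ?V) {F. F facet_of P \<and> v \<in> F}"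
        using hullF by (intro inj_onI) (metis mem_Collect_eq)
      ultimately show ?thesis using deg [OF v] by (simp add: card_image)
    qed
    show "0 < q" by (fact q)
    show "0 < s"
    proof -
      obtain v where "v \<in> ?V" using neV by blast
      then have "card {F. F facet_of P \<and> v \<in> F} > 0" using deg q by simp
      then obtain F where "F facet_of P" by (auto simp: card_gt_0_iff)
      then obtain m e f where "polygon_frame p r e f" using facet_frame by blast
      then show ?thesis unfolding s_def by (rule polygon_frame.side_pos)
    qed
    show "card {x \<in> W. dist x v = s} = 2" if W: "W \<in> ?FF" "v \<in> W" for W v
    proof -
      from W(1) obtain m e f where fr: "polygon_frame p r e f" and W': "W = range (polygon_frame.vtx p r m e f)"
        using facet_frame by blast
      show ?thesis
        using polygon_frame.neighbours_on_polygon [OF fr W(2) [unfolded W']] unfolding s_def W' .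
    qed
    show "(dist u w)\<^sup>2 = (1 + (1 + 2 * cos (2 * pi / p))) * s\<^sup>2 \<and>
        u + (1 + 2 * cos (2 * pi / p)) *\<^sub>R (w - v) \<in> W \<and>
        dist (u + (1 + 2 * cos (2 * pi / p)) *\<^sub>R (w - v)) w = s \<and>
        u + (1 + 2 * cos (2 * pi / p)) *\<^sub>R (w - v) \<noteq> v"
      if W: "W \<in> ?FF" "u \<in> W" "v \<in> W" "w \<in> W" "u \<noteq> w" "dist u v = s" "dist w v = s" for W u v w
    proof -
      from W(1) obtain m e f where fr: "polygon_frame p r e f" and W': "W = range (polygon_frame.vtx p r m e f)"
        using facet_frame by blast
      show ?thesis
        using polygon_frame.polygon_step [OF fr W(2-4) [unfolded W'] W(5) W(6,7) [unfolded s_def]]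
        unfolding W' s_def by simp
    qed
    show "\<exists>W'\<in>?FF. W' \<noteq> W \<and> u \<in> W' \<and> v \<in> W'"
      if W: "W \<in> ?FF" "u \<in> W" "v \<in> W" "dist u v = s" for W u v
    proof -
      obtain F where F: "F facet_of P" "W = F \<inter> ?V" using W(1) by blast
      obtain m e f where fr: "polygon_frame p r e f" and W': "W = range (polygon_frame.vtx p r m e f)"
        and FW: "F = convex hull W"
        using facet_frame [OF F(1)] F(2) by metis
      have E: "convex hull {u, v} face_of F"
        using polygon_frame.side_face [OF fr W(2,3) [unfolded W'] W(4) [unfolded s_def]]
        unfolding FW W' .
      have "convex hull {u, v} \<noteq> F"
      proof
        assume EF: "convex hull {u, v} = F"
        have "card {z \<in> W. dist z v = s} = 2"
          using polygon_frame.neighbours_on_polygon [OF fr W(3) [unfolded W']] unfolding s_def W' .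
        have "s > 0" unfolding s_def using fr by (rule polygon_frame.side_pos)
        have "W \<subseteq> {u, v}"
        proof
          fix z assume "z \<in> W"
          then have "z extreme_point_of F"
            using F extreme_point_of_face [OF facet_of_imp_face_of [OF F(1)]] by (auto simp: vertices_def)
          then show "z \<in> {u, v}" unfolding EF [symmetric] by (rule extreme_point_of_convex_hull)
        qed
        then have "{z \<in> W. dist z v = s} \<subseteq> {u}" using \<open>s > 0\<close> by auto
        then have "card {z \<in> W. dist z v = s} \<le> card {u}" by (intro card_mono) auto
        with \<open>card {z \<in> W. dist z v = s} = 2\<close> show False by simp
      qed
      then obtain F' where F': "F' facet_of P" "F' \<noteq> F" "convex hull {u, v} \<subseteq> F'"
        using edge_in_second_facet [OF poly F(1) E] by auto
      have "u \<in> F'" "v \<in> F'" using F'(3) by (auto simp: hull_inc subsetD)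
      then have "u \<in> F' \<inter> ?V" "v \<in> F' \<inter> ?V" using W(2,3) F(2) by simp_all
      moreover have "F' \<inter> ?V \<noteq> W" using F'(1,2) hullF FW by metis
      moreover have "F' \<inter> ?V \<in> ?FF" using F'(1) by (intro imageI CollectI)
      ultimately show ?thesis by (intro bexI conjI)
    qed
    show "W = W'"
      if W: "W \<in> ?FF" "W' \<in> ?FF" "{u, v, w} \<subseteq> W" "{u, v, w} \<subseteq> W'" "u \<noteq> v" "v \<noteq> w" "u \<noteq> w"
      for W W' u v w
    proof -
      obtain F F' where F: "F facet_of P" "F' facet_of P" "W = F \<inter> ?V" "W' = F' \<inter> ?V"
        using W(1,2) by blast
      then have "F = F'"
        using facet_determined_by_three_vertices [OF conv F(1,2) _ _ W(5-7) dim] W(3,4) by simp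
      then show ?thesis using F(3,4) by simp
    qed
    show "\<exists>n b. n \<noteq> 0 \<and> (\<forall>x\<in>W. n \<bullet> x = b) \<and> (\<forall>x\<in>?V. n \<bullet> x \<le> b)" if W: "W \<in> ?FF" for W
    proof -
      obtain F where F: "F facet_of P" "W = F \<inter> ?V" using W by blast
      have VP: "?V \<subseteq> P" by (auto simp: vertices_def extreme_point_of_def)
      have "F exposed_face_of P"
        using exposed_face_of_polyhedron [OF poly] facet_of_imp_face_of [OF F(1)] by blast
      then obtain n b where n: "P \<subseteq> {x. n \<bullet> x \<le> b}" "F = P \<inter> {x. n \<bullet> x = b}"
        by (auto simp: exposed_face_of_def)
      have "F \<noteq> P" "F \<noteq> {}" using F(1) by (auto simp: facet_of_def)
      then have "n \<noteq> 0" using n by auto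
      moreover have "\<forall>x\<in>W. n \<bullet> x = b" "\<forall>x\<in>?V. n \<bullet> x \<le> b" using n F(2) VP by auto
      ultimately show ?thesis by blast
    qed
  qed
  then show thesis by (rule that)
qed

section \<open>The sums over the five regular polyhedra\<close>

text \<open>In a regular pentagon \<open>\<kappa>\<close> is the golden ratio. With \<open>t = 2 \<pi> / 5\<close> the angles \<open>3 t\<close> and \<open>2 t\<close> are
  opposite modulo a full turn; equating their cosines gives a cubic equation for \<open>cos t\<close> with the
  spurious root \<open>1\<close>.\<close>
lemma cos_golden: "(1 + 2 * cos (2 * pi / 5))\<^sup>2 = (1 + 2 * cos (2 * pi / 5)) + 1"
proof -
  define t :: real where "t = 2 * pi / 5"
  let ?c = "cos t"
  have "cos (3 * t) = cos (2 * t)"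
  proof -
    have "3 * t = 2 * pi - 2 * t" by (simp add: t_def)
    then show ?thesis by (simp only: cos_diff) simp
  qed
  then have "4 * ?c ^ 3 - 3 * ?c = 2 * ?c\<^sup>2 - 1"
    by (simp add: cos_treble_cos cos_double_cos)
  then have "(?c - 1) * (4 * ?c\<^sup>2 + 2 * ?c - 1) = 0" by algebra
  moreover have "?c \<noteq> 1"
  proof -
    have "cos t < cos 0" by (rule cos_monotone_0_pi) (auto simp: t_def)
    then show ?thesis by simp
  qed
  ultimately have "4 * ?c\<^sup>2 + 2 * ?c - 1 = 0" by simp
  then have "(1 + 2 * ?c)\<^sup>2 = (1 + 2 * ?c) + 1" by algebra
  then show ?thesis by (simp add: t_def)
qed

theorem theorem4p5:
  fixes P :: "(real ^ 3) set" and c :: "real ^ 3"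
  assumes "regular_3_polytope P"
    and "inscribed_in_sphere P c 1"
  shows "(regular_tetrahedron P \<longrightarrow> (\<Sum>d\<in>chord_lengths P. d\<^sup>2) \<in> \<rat>) \<and>
    (regular_octahedron P \<or> cube P \<longrightarrow>
       (\<Sum>d\<in>chord_lengths P. d\<^sup>2) = real (card (vertices P))) \<and>
    (regular_icosahedron P \<or> regular_dodecahedron P \<longrightarrow>
       (\<Sum>d\<in>chord_lengths P. d\<^sup>2) = 2 * real (card (chord_lengths P)) + 2)"
proof -
  define U where "U = {x. c + x \<in> vertices P}"
  let ?FF = "(\<lambda>F. F \<inter> vertices P) ` {F. F facet_of P}"
  have V: "vertices P = (+) c ` U"
  proof (intro equalityI subsetI)
    fix v assume "v \<in> vertices P"
    then have "v - c \<in> U" by (simp add: U_def)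
    then show "v \<in> (+) c ` U" by (rule rev_image_eqI) simp
  qed (auto simp: U_def)
  have D: "chord_lengths P = distances U"
  proof -
    have "chord_lengths P = distances (vertices P)"
      by (simp add: chord_lengths_def distances_def)
    also have "\<dots> = distances U" unfolding V by (rule distances_translation)
    finally show ?thesis .
  qed
  have cardU: "card (vertices P) = card U"
    unfolding V by (simp add: card_image)
  have facets: "\<exists>s. regular_facets (vertices P) ?FF c s (1 + 2 * cos (2 * pi / real p)) q"
    if "regular_polyhedron p q P" "0 < q" for p q
    using regular_polyhedron_facets [OF that(1) assms(2) that(2)] by blast
  have U: "regular_facets.U (vertices P) c = U" if "regular_facets (vertices P) ?FF c s \<kappa> q" for s \<kappa> q
    using regular_facets.U_def [OF that] by (simp add: U_def)
  have unit: "finite U" "U \<noteq> {}" "\<And>x. x \<in> U \<Longrightarrow> norm x = 1"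
    if "regular_facets (vertices P) ?FF c s \<kappa> q" for s \<kappa> q
    using regular_facets.finite_U [OF that] regular_facets.neU [OF that] regular_facets.U_norm [OF that]
    unfolding U [OF that] by auto
  have antipodal_sum: "(\<Sum>d\<in>distances U. d\<^sup>2) = 2 * real (card (distances U)) + 2"
    if "regular_facets (vertices P) ?FF c s \<kappa> q" "\<And>x. x \<in> U \<Longrightarrow> - x \<in> U" for s \<kappa> q
    using sum_distances_antipodal [of U] unit [OF that(1)] that(2) by blast
  have k3: "1 + 2 * cos (2 * pi / real 3) = 0" using cos_120 by simp
  have k4: "1 + 2 * cos (2 * pi / real 4) = 1" by simp
  have "(\<Sum>d\<in>distances U. d\<^sup>2) \<in> \<rat>" if reg: "regular_polyhedron 3 3 P"
  proof -
    obtain s where F: "regular_facets (vertices P) ?FF c s 0 3"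
      using facets [OF reg] unfolding k3 by auto
    have "distances U \<subseteq> {sqrt (8/3)}"
    proof
      fix d assume "d \<in> distances U"
      then obtain x y where xy: "x \<in> U" "y \<in> U" "x \<noteq> y" "d = dist x y"
        by (auto simp: distances_def)
      have "x \<bullet> y = - 1/3"
        using regular_facets.tetrahedron_inner [OF F refl refl, unfolded U [OF F]] xy by blast
      then have "d\<^sup>2 = 8/3"
        using dist_power2_unit [of x y] unit(3) [OF F] xy by simp
      then show "d \<in> {sqrt (8/3)}" using xy by (metis real_sqrt_unique singletonI zero_le_dist)
    qed
    then have "distances U = {} \<or> distances U = {sqrt (8/3)}" by blast
    then show ?thesis by auto
  qed
  moreover have "(\<Sum>d\<in>distances U. d\<^sup>2) = real (card U)" if reg: "regular_polyhedron 3 4 P"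
  proof -
    obtain s where F: "regular_facets (vertices P) ?FF c s 0 4"
      using facets [OF reg] unfolding k3 by auto
    then show ?thesis
      using antipodal_sum [OF F] regular_facets.octahedron_vertices [OF F refl refl]
        regular_facets.antipodal_octahedron [OF F refl refl] unfolding U [OF F] by simp
  qed
  moreover have "(\<Sum>d\<in>distances U. d\<^sup>2) = real (card U)" if reg: "regular_polyhedron 4 3 P"
  proof -
    obtain s where F: "regular_facets (vertices P) ?FF c s 1 3"
      using facets [OF reg] unfolding k4 by auto
    then show ?thesis
      using antipodal_sum [OF F] regular_facets.cube_vertices [OF F refl refl]
        regular_facets.antipodal_cube [OF F refl refl] unfolding U [OF F] by simp
  qed
  moreover have "(\<Sum>d\<in>distances U. d\<^sup>2) = 2 * real (card (distances U)) + 2" if reg: "regular_polyhedron 3 5 P"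
  proof -
    obtain s where F: "regular_facets (vertices P) ?FF c s 0 5"
      using facets [OF reg] unfolding k3 by auto
    show ?thesis
      using antipodal_sum [OF F] regular_facets.antipodal_icosahedron [OF F refl refl]
      unfolding U [OF F] by blast
  qed
  moreover have "(\<Sum>d\<in>distances U. d\<^sup>2) = 2 * real (card (distances U)) + 2" if reg: "regular_polyhedron 5 3 P"
  proof -
    obtain s where F: "regular_facets (vertices P) ?FF c s (1 + 2 * cos (2 * pi / 5)) 3"
      using facets [OF reg] by auto
    show ?thesis
      using antipodal_sum [OF F] regular_facets.antipodal_dodecahedron [OF F refl cos_golden]
      unfolding U [OF F] by blast
  qed
  ultimately show ?thesis
    unfolding D cardU regular_tetrahedron_def regular_octahedron_def cube_def
      regular_icosahedron_def regular_dodecahedron_def by blast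
qed

end
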